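(* Let $L>0$, let $\Omega=\{(x,y,z)\in\mathbb{R}^3 : 0<z<L\}$, and let $\kappa_H>0$, $\kappa_3>0$, $\nu_H\geq 0$, $\nu_3\geq 0$ and $R\in\mathbb{R}$ be constants. Let $X=u e_1+v e_2+w e_3$ be a $C^\infty$ vector field and $p,T$ be $C^\infty$ real-valued functions, all defined on $\Omega$ and smooth up to the boundary (i.e. $C^\infty$ on $\overline{\Omega}$), satisfying the stationary primitive equations $$ \begin{aligned} &X\cdot \nabla u + \partial_x p - Rv = \nu_H \Delta_H u + \nu_3 \partial_{zz}u,\\ &X\cdot \nabla v + \partial_y p + Ru = \nu_H \Delta_H v + \nu_3 \partial_{zz}v,\\ &\partial_z p+T =0,\\ &X\cdot \nabla T =\kappa_{H} \Delta_{H} T+\kappa_{3} \partial_{zz}T,\\ &\operatorname{div} X =0 \end{aligned} $$ on $\Omega$, together with the boundary conditions $$w|_{z=0}=w|_{z=L}=0,\qquad \partial_z T|_{z=0}=\partial_z T|_{z=L}=0 .$$ Assume that the support of $X$ is a compact set contained in the open set $\Omega$. Then $X\equiv 0$ on $\Omega$, and there exist constants $a,b\in\mathbb{R}$ such that $p=-az+b$ and $T=a$ on $\Omega$.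
   Context: $e_1,e_2,e_3$ is the standard basis of $\mathbb{R}^3$ with Cartesian coordinates $(x,y,z)$. $X\cdot\nabla f = u\,\partial_x f+v\,\partial_y f+w\,\partial_z f$ for a function $f$. $\Delta_H=\partial_{xx}+\partial_{yy}$ is the horizontal Laplacian, and $\operatorname{div} X=\partial_x u+\partial_y v+\partial_z w$. The support of $X$ is the closure of the set of points where $X$ does not vanish; the hypothesis that it is a compact subset of the open channel $\Omega$ means in particular that $X$ vanishes in a neighborhood of $z=0$ and of $z=L$. No boundedness or decay assumption is made on $p$ or $T$. *)

theory Defs
  imports "HOL-Analysis.Analysis"
begin

definition channel :: "real \<Rightarrow> (real^3) set" where
  "channel L = {q. 0 < q $ 3 \<and> q $ 3 < L}"

(* The derivative is taken within S, so that values of f off S play no role: at interior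
   points of S this is the ordinary partial derivative, and at boundary points of the closed
   channel it is the one-sided one (both facts are proved below). *)
definition partial :: "(real^'n) set \<Rightarrow> 'n \<Rightarrow> (real^'n \<Rightarrow> 'b::real_normed_vector) \<Rightarrow> real^'n \<Rightarrow> 'b"
  where "partial S i f q = frechet_derivative f (at q within S) (axis i 1)"

(* For S the closure of the channel, this says that f is C^k in the channel and that its partial
   derivatives of order at most k extend continuously to the closure. *)
primrec Ck_on :: "nat \<Rightarrow> (real^'n) set \<Rightarrow> (real^'n \<Rightarrow> 'b::real_normed_vector) \<Rightarrow> bool" where
  "Ck_on 0 S f \<longleftrightarrow> continuous_on S f"
| "Ck_on (Suc k) S f \<longleftrightarrow> f differentiable_on S \<and> (\<forall>i. Ck_on k S (partial S i f))"

definition smooth_on :: "(real^'n) set \<Rightarrow> (real^'n \<Rightarrow> 'b::real_normed_vector) \<Rightarrow> bool" where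
  "smooth_on S f \<longleftrightarrow> (\<forall>k. Ck_on k S f)"

definition advect :: "(real^3) set \<Rightarrow> (real^3 \<Rightarrow> real^3) \<Rightarrow> (real^3 \<Rightarrow> real) \<Rightarrow> real^3 \<Rightarrow> real" where
  "advect S X f q = X q $ 1 * partial S 1 f q + X q $ 2 * partial S 2 f q + X q $ 3 * partial S 3 f q"

definition laplacian_H :: "(real^3) set \<Rightarrow> (real^3 \<Rightarrow> real) \<Rightarrow> real^3 \<Rightarrow> real" where
  "laplacian_H S f q = partial S 1 (partial S 1 f) q + partial S 2 (partial S 2 f) q"

definition divergence :: "(real^3) set \<Rightarrow> (real^3 \<Rightarrow> real^3) \<Rightarrow> real^3 \<Rightarrow> real" where
  "divergence S X q = partial S 1 (\<lambda>r. X r $ 1) q + partial S 2 (\<lambda>r. X r $ 2) q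
     + partial S 3 (\<lambda>r. X r $ 3) q"

lemma partial_interior:
  "q \<in> interior S \<Longrightarrow> partial S i f q = frechet_derivative f (at q) (axis i 1)"
  unfolding partial_def by (metis at_within_interior)

lemma closure_channel:
  assumes "L > 0"
  shows "closure (channel L) = {q. 0 \<le> q $ 3 \<and> q $ 3 \<le> L}"
proof
  have "closed {q::real^3. 0 \<le> q $ 3 \<and> q $ 3 \<le> L}"
    by (intro closed_Collect_conj closed_Collect_le continuous_intros)
  then show "closure (channel L) \<subseteq> {q. 0 \<le> q $ 3 \<and> q $ 3 \<le> L}"
    by (intro closure_minimal) (auto simp: channel_def)
  show "{q. 0 \<le> q $ 3 \<and> q $ 3 \<le> L} \<subseteq> closure (channel L)"
  proof
    fix q :: "real^3" assume q: "q \<in> {q. 0 \<le> q $ 3 \<and> q $ 3 \<le> L}"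
    let ?s = "\<lambda>n. q + inverse (real (Suc n)) *\<^sub>R axis 3 (L / 2 - q $ 3)"
    have "?s n \<in> channel L" for n
    proof -
      define t where "t = inverse (real (Suc n))"
      have t: "0 < t" "t \<le> 1"
        unfolding t_def by (simp_all add: inverse_le_1_iff)
      have e: "?s n $ 3 = q $ 3 + t * (L / 2 - q $ 3)"
        unfolding t_def by (simp add: axis_def)
      have "0 < t * L" using t assms by simp
      moreover have "0 \<le> (1 - t) * q $ 3" using q t by simp
      moreover have "(1 - t) * q $ 3 \<le> (1 - t) * L" using q t by (intro mult_left_mono) simp_all
      ultimately have "0 < q $ 3 + t * (L / 2 - q $ 3)" "q $ 3 + t * (L / 2 - q $ 3) < L"
        by (simp_all add: left_diff_distrib right_diff_distrib)
      then show ?thesis unfolding channel_def mem_Collect_eq e by simp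
    qed
    moreover have "?s \<longlonglongrightarrow> q + 0 *\<^sub>R axis 3 (L / 2 - q $ 3)"
      by (intro tendsto_intros LIMSEQ_inverse_real_of_nat)
    ultimately show "q \<in> closure (channel L)"
      unfolding closure_sequential by (intro exI[of _ ?s] conjI allI) simp_all
  qed
qed

lemma partial_closure_channel:
  assumes "L > 0" "q \<in> closure (channel L)"
    and "(f has_derivative f') (at q within closure (channel L))"
  shows "partial (closure (channel L)) i f q = f' (axis i 1)"
proof -
  let ?S = "closure (channel L)"
  have "\<exists>d. 0 < \<bar>d\<bar> \<and> \<bar>d\<bar> < e \<and> q + d *\<^sub>R b \<in> ?S" if b: "b \<in> Basis" and e: "e > 0" for e and b :: "real^3"
  proof -
    obtain j where j: "b = axis j 1" using b by (auto simp: Basis_vec_def)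
    define m where "m = min (e / 2) (L / 2)"
    have m: "0 < m" "m < e" "m \<le> L / 2" using e assms(1) by (auto simp: m_def)
    define d where "d = (if q $ 3 \<le> L / 2 then m else - m)"
    have "0 < \<bar>d\<bar> \<and> \<bar>d\<bar> < e" using m by (auto simp: d_def)
    moreover have "q + d *\<^sub>R b \<in> ?S"
      using assms(2) m unfolding closure_channel[OF assms(1)] by (auto simp: j d_def axis_def)
    ultimately show ?thesis by blast
  qed
  moreover have "(f has_derivative frechet_derivative f (at q within ?S)) (at q within ?S)"
    using assms(3) frechet_derivative_works differentiableI by blast
  ultimately have "frechet_derivative f (at q within ?S) = f'"
    using assms(3) frechet_derivative_unique_within by blast
  then show ?thesis by (simp add: partial_def)
qed

end

theory Submission
  imports Defs
begin

text \<open>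
  Off the support of X the horizontal gradient of p vanishes and T = - dp/dz, so p and T depend on z
  only there; the heat equation makes T'' = 0, and the Neumann condition gives T = a, p = - a z + b
  outside a compact box.  Hence T - a extends by zero to the whole space and the energy identity gives
  T = a everywhere, so the pressure drops out of the horizontal momentum equations.

  If one of the viscosities is positive, the energy identity for (u, v) gives u = v = 0.  If both vanish and
  R = 0, testing with the coordinates x and y gives the integrals of u squared and v squared.  If both
  vanish and R is nonzero, then A = u - R y and B = v + R x are constant along X, so the
  divergence-free field N = grad A x grad B is parallel to X, and E = u^2 + v^2 satisfies
  N . grad E = 0.  The field z F(E) N is thus a flux for F(E) N_3, where N_3 = R^2 + J and J is a
  divergence.  With F(E) = E / (E + d^2), letting d tend to 0, the integral of F(E) N_3 tends to R^2 times the
  measure of the set where E > 0, because grad u = grad v = 0 almost everywhere on E = 0.  So E = 0.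
  Finally dw/dz = 0 gives w = 0.
\<close>


section \<open>Partial derivatives along coordinate lines\<close>

abbreviation pd :: "'n::finite \<Rightarrow> (real^'n \<Rightarrow> 'b::real_normed_vector) \<Rightarrow> real^'n \<Rightarrow> 'b" where
  "pd \<equiv> partial UNIV"

text \<open>The derivative is an explicit second function, so product and chain rules yield closed
  formulas by one-variable calculus. Parameter 0 at every base point is enough, since a line can be
  re-based at any of its points.\<close>

definition has_pd :: "'n::finite \<Rightarrow> (real^'n \<Rightarrow> real) \<Rightarrow> (real^'n \<Rightarrow> real) \<Rightarrow> bool" where
  "has_pd i f g \<longleftrightarrow> (\<forall>q. ((\<lambda>t. f (q + t *\<^sub>R axis i 1)) has_real_derivative g q) (at 0))"

text \<open>Passage from \<open>partial\<close> to one-variable calculus: at an interior point the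
  derivative within S is the full one, and the chain rule applies along the coordinate line.\<close>

lemma has_partial_line:
  fixes f :: "real^'n \<Rightarrow> real"
  assumes "f differentiable_on S" and "q + t *\<^sub>R axis i 1 \<in> interior S"
  shows "((\<lambda>t. f (q + t *\<^sub>R axis i 1)) has_real_derivative partial S i f (q + t *\<^sub>R axis i 1)) (at t)"
proof -
  let ?r = "q + t *\<^sub>R axis i (1::real)"
  define f' where "f' = frechet_derivative f (at ?r)"
  have "f differentiable (at ?r)"
    using assms(1) at_within_interior[OF assms(2)] subsetD[OF interior_subset assms(2)]
    unfolding differentiable_on_def by fastforce
  then have f': "(f has_derivative f') (at ?r)"
    unfolding f'_def by (simp add: frechet_derivative_works)
  have "((\<lambda>t. q + t *\<^sub>R axis i (1::real)) has_derivative (\<lambda>t. t *\<^sub>R axis i 1)) (at t)"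
    using has_derivative_add[OF has_derivative_const has_derivative_scaleR_left[OF has_derivative_ident], of q "axis i (1::real)"] by simp
  from diff_chain_at[OF this f']
  have "((\<lambda>t. f (q + t *\<^sub>R axis i 1)) has_derivative (\<lambda>t. f' (t *\<^sub>R axis i 1))) (at t)"
    by (simp add: o_def)
  moreover have "f' (t *\<^sub>R axis i 1) = f' (axis i 1) * t" for t
    unfolding linear_scale[OF has_derivative_linear[OF f']] by (simp only: real_scaleR_def mult.commute)
  moreover have "partial S i f ?r = f' (axis i 1)"
    using assms(2) by (simp add: partial_interior f'_def)
  ultimately show ?thesis
    by (simp add: has_field_derivative_def)
qed

lemma has_pd_line:
  assumes "has_pd i f g"
  shows "((\<lambda>t. f (q + t *\<^sub>R axis i 1)) has_real_derivative g (q + t *\<^sub>R axis i 1)) (at t)"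
proof -
  have "((\<lambda>s. f ((q + t *\<^sub>R axis i 1) + s *\<^sub>R axis i 1)) has_real_derivative g (q + t *\<^sub>R axis i 1)) (at 0)"
    using assms by (simp add: has_pd_def)
  then show ?thesis
    using DERIV_shift[of "\<lambda>s. f (q + s *\<^sub>R axis i 1)" "g (q + t *\<^sub>R axis i 1)" 0 t]
    by (simp add: scaleR_add_left add.assoc add.commute[of "t *\<^sub>R _"])
qed

section \<open>Locality of derivatives and extension by a constant\<close>

lemma frechet_derivative_cong_open:
  assumes "open A" "q \<in> A" "\<And>x. x \<in> A \<Longrightarrow> f x = g x"
  shows "frechet_derivative f (at q) = frechet_derivative g (at q)"
proof -
  have "(f has_derivative D) (at q) \<longleftrightarrow> (g has_derivative D) (at q)" for D
    using has_derivative_transform_within_open[of _ D q UNIV A] assms by metis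
  then show ?thesis by (simp add: frechet_derivative_def)
qed

text \<open>U and the complement of K are open and cover the space; the extended function agrees
  with f on the first and is constant on the second.\<close>

lemma partial_extend_const:
  assumes "open U" "closed K" "K \<subseteq> U" "U \<subseteq> S" and f: "\<And>q. q \<in> U - K \<Longrightarrow> f q = c"
  shows "pd i (\<lambda>q. if q \<in> U then f q else c) = (\<lambda>q. if q \<in> U then partial S i f q else 0)"
proof
  fix q
  let ?g = "\<lambda>q. if q \<in> U then f q else c"
  show "pd i ?g q = (if q \<in> U then partial S i f q else 0)"
  proof (cases "q \<in> U")
    case True
    then have "q \<in> interior S" using assms interior_maximal by blast
    moreover have "frechet_derivative ?g (at q) = frechet_derivative f (at q)"
      by (rule frechet_derivative_cong_open[OF \<open>open U\<close> True]) simp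
    ultimately show ?thesis using True by (simp add: partial_interior)
  next
    case False
    have "frechet_derivative ?g (at q) = frechet_derivative (\<lambda>_. c) (at q)"
      by (rule frechet_derivative_cong_open[of "- K"]) (use assms False in auto)
    then show ?thesis using False by (simp add: partial_interior)
  qed
qed

lemma partial_eq_0_open:
  assumes "open A" "A \<subseteq> S" "q \<in> A" "\<And>x. x \<in> A \<Longrightarrow> f x = c"
  shows "partial S i f q = 0"
proof -
  have "q \<in> interior S" using assms interior_maximal by blast
  moreover have "frechet_derivative f (at q) = frechet_derivative (\<lambda>_. c) (at q)"
    by (rule frechet_derivative_cong_open[of A]) (use assms in auto)
  ultimately show ?thesis by (simp add: partial_interior)
qed

text \<open>Each partial derivative of the extension is the extension by 0 of the partial
  derivative, so the induction has to let the constant vary together with f.\<close>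

lemma Ck_on_extend_const:
  assumes "open U" "closed K" "K \<subseteq> U" "U \<subseteq> S"
  shows "Ck_on k S f \<Longrightarrow> (\<And>q. q \<in> U - K \<Longrightarrow> f q = c) \<Longrightarrow>
    Ck_on k UNIV (\<lambda>q. if q \<in> U then f q else c)"
proof (induction k arbitrary: f c)
  case 0
  have "continuous_on (U \<union> - K) (\<lambda>q. if q \<in> U then f q else c)"
  proof (rule continuous_on_open_Un)
    show "continuous_on U (\<lambda>q. if q \<in> U then f q else c)"
      using 0(1) continuous_on_subset[OF _ \<open>U \<subseteq> S\<close>] by (simp cong: continuous_on_cong)
    have "continuous_on (- K) (\<lambda>q. if q \<in> U then f q else c) \<longleftrightarrow> continuous_on (- K) (\<lambda>_. c)"
      using 0(2) by (intro continuous_on_cong) auto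
    then show "continuous_on (- K) (\<lambda>q. if q \<in> U then f q else c)" by simp
  qed (use assms in auto)
  moreover have "U \<union> - K = UNIV" using assms by auto
  ultimately show ?case by simp
next
  case (Suc k)
  let ?g = "\<lambda>q. if q \<in> U then f q else c"
  have z: "partial S i f q = 0" if "q \<in> U - K" for i q
    by (rule partial_eq_0_open[of "U - K"]) (use assms that Suc.prems(2) in auto)
  have "?g differentiable (at q)" for q
  proof (cases "q \<in> U")
    case True
    have "f differentiable (at q)"
      using Suc.prems(1) True assms
      by (metis Ck_on.simps(2) at_within_open differentiable_on_def differentiable_on_subset)
    then show ?thesis
      using has_derivative_transform_within_open[of f _ q UNIV U ?g] True \<open>open U\<close>
      unfolding differentiable_def by auto
  next
    case False
    have "(?g has_derivative (\<lambda>_. 0)) (at q)"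
      by (rule has_derivative_transform_within_open[of "\<lambda>_. c" _ q UNIV "- K"])
         (use assms False Suc.prems(2) in auto)
    then show ?thesis by (rule differentiableI)
  qed
  moreover have "Ck_on k UNIV (pd i ?g)" for i
  proof -
    have "pd i ?g = (\<lambda>q. if q \<in> U then partial S i f q else 0)"
      by (rule partial_extend_const[OF assms]) (rule Suc.prems(2))
    then show ?thesis using Suc.IH[of "partial S i f" 0] Suc.prems(1) z by simp
  qed
  ultimately show ?case by (simp add: differentiable_on_def)
qed

section \<open>Components, second derivatives and their symmetry\<close>

lemma Ck_on_component:
  "Ck_on k UNIV F \<Longrightarrow> Ck_on k UNIV (\<lambda>q. F q $ i)"
proof (induction k arbitrary: F)
  case 0
  then show ?case by (auto intro!: continuous_intros)
next
  case (Suc k)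
  have F: "F differentiable (at q)" for q
    using Suc.prems by (simp add: differentiable_on_def)
  have D: "((\<lambda>q. F q $ i) has_derivative (\<lambda>h. frechet_derivative F (at q) h $ i)) (at q)" for q
    using F[of q] bounded_linear.has_derivative[OF bounded_linear_vec_nth]
    by (simp add: frechet_derivative_works)
  have "pd j (\<lambda>q. F q $ i) = (\<lambda>q. pd j F q $ i)" for j
    using frechet_derivative_at[OF D] by (simp add: partial_def fun_eq_iff)
  then show ?case
    using Suc D by (auto simp: differentiable_on_def differentiable_def)
qed

lemma Ck_on_2D:
  assumes "Ck_on 2 UNIV f"
  shows "has_pd i f (pd i f)" "has_pd j (pd i f) (pd j (pd i f))"
    "continuous_on UNIV f" "continuous_on UNIV (pd i f)" "continuous_on UNIV (pd j (pd i f))"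
proof -
  have d: "f differentiable_on UNIV" "pd i f differentiable_on UNIV" "continuous_on UNIV (pd j (pd i f))"
    using assms by (auto simp: numeral_2_eq_2)
  show "has_pd i f (pd i f)" "has_pd j (pd i f) (pd j (pd i f))"
    using has_partial_line[OF d(1), of _ 0] has_partial_line[OF d(2), of _ 0] by (auto simp: has_pd_def)
  show "continuous_on UNIV f" "continuous_on UNIV (pd i f)" "continuous_on UNIV (pd j (pd i f))"
    using d by (auto intro: differentiable_imp_continuous_on)
qed

lemma pd_bounded_support:
  assumes "bounded {q. f q \<noteq> 0}"
  shows "bounded {q. pd i f q \<noteq> 0}"
proof -
  have "pd i f q = 0" if "q \<notin> closure {q. f q \<noteq> 0}" for q
    using closure_subset[of "{q. f q \<noteq> 0}"] that by (intro partial_eq_0_open[where A = "- closure {q. f q \<noteq> 0}" and c = 0]) auto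
  then have "{q. pd i f q \<noteq> 0} \<subseteq> closure {q. f q \<noteq> 0}" by auto
  then show ?thesis using assms bounded_closure bounded_subset by blast
qed

text \<open>Both mixed partials are, up to the factor r squared, the same second difference of f.\<close>
lemma pd_commute:
  fixes f :: "real^'n \<Rightarrow> real"
  assumes "Ck_on 2 UNIV f"
  shows "pd i (pd j f) = pd j (pd i f)"
proof
  fix q
  have *: "\<exists>s t. 0 \<le> s \<and> s \<le> r \<and> 0 \<le> t \<and> t \<le> r \<and>
       f (q + r *\<^sub>R axis i 1 + r *\<^sub>R axis j 1) - f (q + r *\<^sub>R axis j 1) - f (q + r *\<^sub>R axis i 1) + f q
       = r * r * pd j (pd i f) (q + s *\<^sub>R axis i 1 + t *\<^sub>R axis j 1)"
    if r: "r > 0" for r and i j :: 'n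
  proof -
    \<comment> \<open>\<open>?h\<close> is the first difference of f in direction j, followed along
      direction i. The mean value theorem in s and then in t turns the second difference into a
      mixed partial at a nearby point.\<close>
    let ?h = "\<lambda>s. f ((q + r *\<^sub>R axis j 1) + s *\<^sub>R axis i 1) - f (q + s *\<^sub>R axis i 1)"
    note hp = Ck_on_2D(1,2)[OF assms, THEN has_pd_line]
    have "\<exists>s::real. s > 0 \<and> s < r \<and> ?h r - ?h 0 = (r - 0) * (pd i f ((q + r *\<^sub>R axis j 1) + s *\<^sub>R axis i 1)
          - pd i f (q + s *\<^sub>R axis i 1))"
      by (rule MVT2) (use r in \<open>auto intro!: DERIV_diff hp\<close>)
    then obtain s where s: "0 < s" "s < r" "?h r - ?h 0 = r * (pd i f ((q + r *\<^sub>R axis j 1) + s *\<^sub>R axis i 1)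
          - pd i f (q + s *\<^sub>R axis i 1))" by auto
    let ?k = "\<lambda>t. pd i f ((q + s *\<^sub>R axis i 1) + t *\<^sub>R axis j 1)"
    have "\<exists>t::real. t > 0 \<and> t < r \<and> ?k r - ?k 0 = (r - 0) * pd j (pd i f) ((q + s *\<^sub>R axis i 1) + t *\<^sub>R axis j 1)"
      by (rule MVT2) (use r in \<open>auto intro!: hp\<close>)
    then obtain t where t: "0 < t" "t < r" "?k r - ?k 0 = r * pd j (pd i f) ((q + s *\<^sub>R axis i 1) + t *\<^sub>R axis j 1)"
      by auto
    have "?h r - ?h 0 = r * (?k r - ?k 0)"
      unfolding s(3) by (simp add: algebra_simps)
    then show ?thesis
      using s(1,2) t by (intro exI[of _ s] exI[of _ t]) (simp add: algebra_simps)
  qed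
  let ?a = "pd i (pd j f) q" and ?b = "pd j (pd i f) q"
  have "\<bar>?a - ?b\<bar> < e" if e: "e > 0" for e
  proof -
    have c: "isCont (pd i (pd j f)) q" "isCont (pd j (pd i f)) q"
      using Ck_on_2D(5)[OF assms] by (auto simp: continuous_on_eq_continuous_at)
    obtain d1 where d1: "d1 > 0" "\<And>x. dist x q < d1 \<Longrightarrow> dist (pd i (pd j f) x) ?a < e/2"
      using c(1) e unfolding continuous_at_eps_delta by (metis half_gt_zero)
    obtain d2 where d2: "d2 > 0" "\<And>x. dist x q < d2 \<Longrightarrow> dist (pd j (pd i f) x) ?b < e/2"
      using c(2) e unfolding continuous_at_eps_delta by (metis half_gt_zero)
    \<comment> \<open>Both intermediate points lie within 2 * r of q, hence in both continuity
      balls.\<close>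
    define r where "r = min d1 d2 / 3"
    have r: "r > 0" "2 * r < d1" "2 * r < d2" using d1(1) d2(1) by (auto simp: r_def min_def)
    have close: "dist (q + s *\<^sub>R axis i 1 + t *\<^sub>R axis j 1) q \<le> 2 * r"
      if "0 \<le> s" "s \<le> r" "0 \<le> t" "t \<le> r" for s t and i j :: 'n
      using that norm_triangle_ineq[of "s *\<^sub>R axis i (1::real)" "t *\<^sub>R axis j (1::real)"]
      by (simp add: dist_norm algebra_simps)
    obtain s t where 1: "0 \<le> s" "s \<le> r" "0 \<le> t" "t \<le> r"
       "f (q + r *\<^sub>R axis i 1 + r *\<^sub>R axis j 1) - f (q + r *\<^sub>R axis j 1) - f (q + r *\<^sub>R axis i 1) + f q
       = r * r * pd j (pd i f) (q + s *\<^sub>R axis i 1 + t *\<^sub>R axis j 1)"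
      using *[OF r(1), of i j] by auto
    obtain s' t' where 2: "0 \<le> s'" "s' \<le> r" "0 \<le> t'" "t' \<le> r"
       "f (q + r *\<^sub>R axis j 1 + r *\<^sub>R axis i 1) - f (q + r *\<^sub>R axis i 1) - f (q + r *\<^sub>R axis j 1) + f q
       = r * r * pd i (pd j f) (q + s' *\<^sub>R axis j 1 + t' *\<^sub>R axis i 1)"
      using *[OF r(1), of j i] by auto
    have "r * r * pd j (pd i f) (q + s *\<^sub>R axis i 1 + t *\<^sub>R axis j 1)
        = r * r * pd i (pd j f) (q + s' *\<^sub>R axis j 1 + t' *\<^sub>R axis i 1)"
      unfolding 1(5)[symmetric] 2(5)[symmetric] by (simp add: algebra_simps)
    then have "pd j (pd i f) (q + s *\<^sub>R axis i 1 + t *\<^sub>R axis j 1)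
        = pd i (pd j f) (q + s' *\<^sub>R axis j 1 + t' *\<^sub>R axis i 1)" using r(1) by simp
    moreover have "dist (pd i (pd j f) (q + s' *\<^sub>R axis j 1 + t' *\<^sub>R axis i 1)) ?a < e/2"
      by (rule d1(2)) (use close[OF 2(1-4), of j i] r in linarith)
    moreover have "dist (pd j (pd i f) (q + s *\<^sub>R axis i 1 + t *\<^sub>R axis j 1)) ?b < e/2"
      by (rule d2(2)) (use close[OF 1(1-4), of i j] r in linarith)
    ultimately show ?thesis unfolding dist_real_def by arith
  qed
  then show "?a = ?b" by (metis eq_iff_diff_eq_0 less_irrefl zero_less_abs_iff)
qed


section \<open>Integrals of partial derivatives\<close>

lemma integrable_continuous_bounded_support:
  fixes f :: "'a::euclidean_space \<Rightarrow> real"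
  assumes "continuous_on UNIV f" "bounded {q. f q \<noteq> 0}"
  shows "integrable lborel f"
proof -
  let ?K = "closure {q. f q \<noteq> 0}"
  have "integrable lborel (\<lambda>q. indicator ?K q *\<^sub>R f q)"
    by (rule borel_integrable_compact) (use assms continuous_on_subset in auto)
  moreover have "(\<lambda>q. indicator ?K q *\<^sub>R f q) = f"
    using closure_subset[of "{q. f q \<noteq> 0}"] by (auto simp: indicator_def fun_eq_iff)
  ultimately show ?thesis by simp
qed

text \<open>The set where f is nonzero is null because f is nonnegative with integral 0, and open
  because f is continuous; a nonempty open set is not null.\<close>

lemma integral_eq_0_imp_eq_0:
  fixes f :: "'a::euclidean_space \<Rightarrow> real"
  assumes c: "continuous_on UNIV f" and nn: "\<And>q. f q \<ge> 0" and i: "has_bochner_integral lborel f 0"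
  shows "f q = 0"
proof -
  have "AE q in lborel. f q = 0"
    using i nn integral_nonneg_eq_0_iff_AE[of lborel f] by (auto simp: has_bochner_integral_iff)
  moreover have o: "open {q. f q \<noteq> 0}"
    using c by (intro open_Collect_neq) auto
  ultimately have "{q. f q \<noteq> 0} \<in> null_sets lborel"
    using AE_iff_null_sets[of "{q. f q \<noteq> 0}" lborel] by simp
  then have "{q. f q \<noteq> 0} \<in> null_sets lebesgue"
    by (rule null_sets_completionI)
  then have "negligible {q. f q \<noteq> 0}" by (simp add: negligible_iff_null_sets)
  then have "{q. f q \<noteq> 0} = {}" using o open_not_negligible by blast
  then show ?thesis by auto
qed

lemma lborel_integral_translation:
  fixes f :: "'a::euclidean_space \<Rightarrow> real"
  assumes "f \<in> borel_measurable borel"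
  shows "(LINT q|lborel. f (c + q)) = (LINT q|lborel. f q)"
proof -
  have "(LINT q|lborel. f q) = (LINT q|distr lborel borel ((+) c). f q)"
    by (simp add: lborel_distr_plus)
  also have "\<dots> = (LINT q|lborel. f (c + q))"
    by (rule integral_distr) (use assms in auto)
  finally show ?thesis ..
qed

text \<open>By translation invariance the difference quotients of F have integral 0.\<close>
lemma has_pd_integral_0:
  fixes F G :: "real^'n \<Rightarrow> real"
  assumes F: "continuous_on UNIV F" and G: "continuous_on UNIV G"
    and b: "bounded {q. F q \<noteq> 0}" and pd: "has_pd i F G"
  shows "has_bochner_integral lborel G 0"
proof -
  let ?e = "axis i (1::real)"
  obtain r where r: "\<And>q. F q \<noteq> 0 \<Longrightarrow> norm q \<le> r"
    using b unfolding bounded_iff by auto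
  have F0: "F q = 0" if "norm q > r" for q using r[of q] that by force
  have G0: "G q = 0" if q: "norm q > r" for q
  proof -
    have "((\<lambda>t. F (q + t *\<^sub>R ?e)) has_real_derivative 0) (at 0)"
    proof (rule has_field_derivative_transform_within[where f = "\<lambda>_. 0" and d = "norm q - r"])
      fix t :: real assume "dist t 0 < norm q - r"
      then have "norm (q + t *\<^sub>R ?e) > r"
        using norm_triangle_ineq2[of q "- t *\<^sub>R ?e"] by (simp add: dist_norm)
      then show "0 = F (q + t *\<^sub>R ?e)" using F0 by simp
    qed (use q in auto)
    moreover have "((\<lambda>t. F (q + t *\<^sub>R ?e)) has_real_derivative G q) (at 0)"
      using pd by (simp add: has_pd_def)
    ultimately show ?thesis using DERIV_unique by blast
  qed
  obtain C where C: "C \<ge> 0" "\<And>q. \<bar>G q\<bar> \<le> C"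
  proof -
    have "compact (G ` cball 0 r)"
      using G by (intro compact_continuous_image) (auto intro: continuous_on_subset)
    then have "bounded (G ` cball 0 r)" by (rule compact_imp_bounded)
    then obtain C where "\<forall>q\<in>cball 0 r. \<bar>G q\<bar> \<le> C"
      unfolding bounded_iff by auto
    \<comment> \<open>Taking the maximum with 0 covers the case r < 0, in which the ball is empty
      and C may be negative.\<close>
    then have "\<bar>G q\<bar> \<le> max C 0" for q
      using G0[of q] by (cases "norm q \<le> r") (auto simp: le_max_iff_disj)
    then show ?thesis using that[of "max C 0"] by simp
  qed
  \<comment> \<open>Difference quotients with step 1/(n+1). By the mean value theorem they are
    values of G, hence bounded by C; as the step is at most 1, they vanish off the ball of radius r
    + 1. This gives the dominating function \<open>?w\<close>.\<close>
  define s where "s n q = (F (inverse (real (Suc n)) *\<^sub>R ?e + q) - F q) / inverse (real (Suc n))" for n q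
  let ?w = "\<lambda>q. indicator (cball 0 (r + 1)) q * C"
  have mF: "F \<in> borel_measurable borel" and mG: "G \<in> borel_measurable borel"
    using F G by (auto intro: borel_measurable_continuous_onI)
  have shift: "(\<lambda>q. F (c + q)) \<in> borel_measurable borel" for c
    using mF by simp
  have iF: "integrable lborel F" by (rule integrable_continuous_bounded_support[OF F b])
  have iFs: "integrable lborel (\<lambda>q. F (c + q))" for c
  proof (rule integrable_continuous_bounded_support)
    show "continuous_on UNIV (\<lambda>q. F (c + q))"
      by (rule continuous_on_compose2[OF F]) (auto intro!: continuous_intros)
    have "{q. F (c + q) \<noteq> 0} \<subseteq> (+) (- c) ` {q. F q \<noteq> 0}"
      by (auto simp: image_iff intro!: exI[of _ "c + _"])
    then show "bounded {q. F (c + q) \<noteq> 0}"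
      using bounded_translation[OF b] bounded_subset by blast
  qed
  have s0: "(LINT q|lborel. s n q) = 0" for n
    unfolding s_def using iF iFs lborel_integral_translation[OF mF] by simp
  have iG: "integrable lborel G"
  proof (rule integrable_continuous_bounded_support[OF G])
    show "bounded {q. G q \<noteq> 0}"
      unfolding bounded_iff using G0 by (intro exI[of _ r]) force
  qed
  have "(\<lambda>n. LINT q|lborel. s n q) \<longlonglongrightarrow> (LINT q|lborel. G q)"
  proof (rule integral_dominated_convergence[where w = ?w])
    show "integrable lborel ?w"
      by (auto intro!: emeasure_compact_finite integrable_mult_left)
    show "AE q in lborel. (\<lambda>n. s n q) \<longlonglongrightarrow> G q"
    proof (rule AE_I2)
      fix q
      have "((\<lambda>t. F (q + t *\<^sub>R ?e)) has_real_derivative G q) (at 0)"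
        using pd by (simp add: has_pd_def)
      then have "((\<lambda>h. (F (q + h *\<^sub>R ?e) - F q) / h) \<longlongrightarrow> G q) (at 0)"
        by (simp add: DERIV_def)
      moreover have "filterlim (\<lambda>n. inverse (real (Suc n))) (at 0) sequentially"
        using LIMSEQ_inverse_real_of_nat by (simp add: filterlim_at)
      ultimately have "(\<lambda>n. (F (q + inverse (real (Suc n)) *\<^sub>R ?e) - F q) / inverse (real (Suc n))) \<longlonglongrightarrow> G q"
        by (rule filterlim_compose)
      then show "(\<lambda>n. s n q) \<longlonglongrightarrow> G q" by (simp add: s_def add.commute)
    qed
    show "AE q in lborel. norm (s n q) \<le> ?w q" for n
    proof (rule AE_I2)
      fix q
      let ?t = "inverse (real (Suc n))"
      have t: "0 < ?t" "?t \<le> 1" by (auto simp: field_simps)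
      show "norm (s n q) \<le> ?w q"
      proof (cases "norm q \<le> r + 1")
        case True
        have "\<exists>z::real. z > 0 \<and> z < ?t \<and> F (q + ?t *\<^sub>R ?e) - F (q + 0 *\<^sub>R ?e) = (?t - 0) * G (q + z *\<^sub>R ?e)"
          by (rule MVT2) (use t has_pd_line[OF pd] in auto)
        then obtain z where "F (q + ?t *\<^sub>R ?e) - F q = ?t * G (q + z *\<^sub>R ?e)" by auto
        then have "s n q = G (q + z *\<^sub>R ?e)" using t by (simp add: s_def add.commute)
        then show ?thesis using C True by simp
      next
        case False
        have "norm (?t *\<^sub>R ?e + q) > r"
          using norm_triangle_ineq2[of q "- ?t *\<^sub>R ?e"] False t by (simp add: add.commute)
        then have "s n q = 0" using False by (simp add: s_def F0)
        then show ?thesis using C by simp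
      qed
    qed
    show "s n \<in> borel_measurable lborel" for n
      unfolding s_def using mF shift by simp
  qed (use mG in auto)
  then have "(LINT q|lborel. G q) = 0"
    using LIMSEQ_unique by (simp add: s0 LIMSEQ_const_iff)
  then show ?thesis using iG by (simp add: has_bochner_integral_iff)
qed

corollary divergence_integral_0:
  fixes F G :: "'n::finite \<Rightarrow> real^'n \<Rightarrow> real"
  assumes "\<And>i. continuous_on UNIV (F i)" "\<And>i. continuous_on UNIV (G i)"
    and "\<And>i. bounded {q. F i q \<noteq> 0}" and "\<And>i. has_pd i (F i) (G i)"
  shows "has_bochner_integral lborel (\<lambda>q. \<Sum>i\<in>UNIV. G i q) 0"
  using has_bochner_integral_sum[of UNIV lborel G "\<lambda>_. 0"] has_pd_integral_0[OF assms] by simp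

section \<open>Calculus rules for partial derivatives along lines\<close>

lemma has_pd_add: "has_pd i f f' \<Longrightarrow> has_pd i g g' \<Longrightarrow> has_pd i (\<lambda>q. f q + g q) (\<lambda>q. f' q + g' q)"
  by (simp add: has_pd_def DERIV_add)

lemma has_pd_diff: "has_pd i f f' \<Longrightarrow> has_pd i g g' \<Longrightarrow> has_pd i (\<lambda>q. f q - g q) (\<lambda>q. f' q - g' q)"
  by (simp add: has_pd_def DERIV_diff)

lemma has_pd_mult: "has_pd i f f' \<Longrightarrow> has_pd i g g' \<Longrightarrow> has_pd i (\<lambda>q. f q * g q) (\<lambda>q. f' q * g q + f q * g' q)"
  unfolding has_pd_def
proof
  fix q
  assume a: "\<forall>q. ((\<lambda>t. f (q + t *\<^sub>R axis i 1)) has_real_derivative f' q) (at 0)"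
    "\<forall>q. ((\<lambda>t. g (q + t *\<^sub>R axis i 1)) has_real_derivative g' q) (at 0)"
  show "((\<lambda>t. f (q + t *\<^sub>R axis i 1) * g (q + t *\<^sub>R axis i 1)) has_real_derivative
      f' q * g q + f q * g' q) (at 0)"
    using DERIV_mult'[OF spec[OF a(1)] spec[OF a(2)], of q q] by (simp add: add.commute)
qed

lemma has_pd_const: "has_pd i (\<lambda>q. c) (\<lambda>q. 0)"
  by (simp add: has_pd_def)

lemma has_pd_coord: "has_pd i (\<lambda>q. q $ j) (\<lambda>q. if i = j then 1 else 0)"
  unfolding has_pd_def
proof
  fix q :: "real^'a"
  have "((\<lambda>t. q $ j + t * axis i 1 $ j) has_real_derivative 0 + axis i 1 $ j) (at 0)"
    by (intro DERIV_add DERIV_const DERIV_cmult_right[OF DERIV_ident, simplified])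
  then show "((\<lambda>t. (q + t *\<^sub>R axis i 1) $ j) has_real_derivative (if i = j then 1 else 0)) (at 0)"
    by (simp add: axis_def eq_commute)
qed

lemma has_pd_compose:
  assumes "has_pd i f f'" "\<And>q. (h has_real_derivative h' (f q)) (at (f q))"
  shows "has_pd i (\<lambda>q. h (f q)) (\<lambda>q. h' (f q) * f' q)"
  unfolding has_pd_def
proof
  fix q
  show "((\<lambda>t. h (f (q + t *\<^sub>R axis i 1))) has_real_derivative h' (f q) * f' q) (at 0)"
    using DERIV_chain2[of h "h' (f q)" "\<lambda>t. f (q + t *\<^sub>R axis i 1)" 0 "f' q" UNIV] assms
    by (simp add: has_pd_def)
qed

lemmas has_pd_intros = has_pd_add has_pd_diff has_pd_mult has_pd_const has_pd_coord

text \<open>Allows \<open>has_pd_intros\<close> to build a derivative by syntax alone, which is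
  afterwards simplified to the form wanted.\<close>

lemma has_pd_cong: "has_pd i f g \<Longrightarrow> (\<And>q. g q = h q) \<Longrightarrow> has_pd i f h"
  by (simp add: has_pd_def)

text \<open>f is constant along every line in direction i, and every such line leaves the bounded
  set where f is nonzero.\<close>

lemma pd_zero_imp_zero:
  fixes f :: "real^'n \<Rightarrow> real"
  assumes "bounded {q. f q \<noteq> 0}" and "has_pd i f (\<lambda>_. 0)"
  shows "f q = 0"
proof -
  obtain r where r: "\<And>q. f q \<noteq> 0 \<Longrightarrow> norm q \<le> r"
    using assms(1) unfolding bounded_iff by auto
  \<comment> \<open>The shifted point has norm at least t - norm q = \<bar>r\<bar> + 1, which
    exceeds r also when r is negative.\<close>
  define t where "t = \<bar>r\<bar> + norm q + 1"
  have "norm (q + t *\<^sub>R axis i 1) > r"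
    using norm_triangle_ineq2[of "t *\<^sub>R axis i (1::real)" "- q"]
    by (simp add: t_def add.commute)
  then have "f (q + t *\<^sub>R axis i 1) = 0" using r by force
  moreover have "f (q + t *\<^sub>R axis i 1) = f (q + 0 *\<^sub>R axis i 1)"
    by (rule DERIV_isconst_all) (rule allI, rule has_pd_line[OF assms(2)])
  ultimately show ?thesis by simp
qed


section \<open>Rigidity of compactly supported stationary flows\<close>

text \<open>The flux with components V_i f^2 / 2 - k_i f d_i f has bounded support, so its
  divergence integrates to 0. In that divergence the term with f^2 / 2 carries div V and drops
  out.\<close>

lemma energy_identity:
  fixes f :: "real^'n \<Rightarrow> real" and V :: "'n \<Rightarrow> real^'n \<Rightarrow> real"
  assumes f: "Ck_on 2 UNIV f" "bounded {q. f q \<noteq> 0}"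
    and V: "\<And>i. Ck_on 2 UNIV (V i)" "\<And>q. (\<Sum>i\<in>UNIV. pd i (V i) q) = 0"
  shows "has_bochner_integral lborel (\<lambda>q. f q * ((\<Sum>i\<in>UNIV. V i q * pd i f q)
      - (\<Sum>i\<in>UNIV. k i * pd i (pd i f) q)) - (\<Sum>i\<in>UNIV. k i * (pd i f q)\<^sup>2)) 0"
proof -
  let ?F = "\<lambda>i q. V i q * (1/2 * (f q * f q)) - k i * (f q * pd i f q)"
  let ?G = "\<lambda>i q. pd i (V i) q * (1/2 * (f q * f q)) + V i q * (f q * pd i f q)
     - k i * ((pd i f q)\<^sup>2 + f q * pd i (pd i f) q)"
  note c = Ck_on_2D(3-5)[OF f(1)] Ck_on_2D(3-4)[OF V(1)]
  have "has_bochner_integral lborel (\<lambda>q. \<Sum>i\<in>UNIV. ?G i q) 0"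
  proof (rule divergence_integral_0[where F = ?F])
    show "continuous_on UNIV (?F i)" "continuous_on UNIV (?G i)" for i
      by (intro continuous_intros c)+
    show "bounded {q. ?F i q \<noteq> 0}" for i
      by (rule bounded_subset[OF f(2)]) auto
    show "has_pd i (?F i) (?G i)" for i
      by (rule has_pd_cong, (rule has_pd_intros Ck_on_2D(1,2)[OF f(1)] Ck_on_2D(1)[OF V(1)])+)
         (simp add: algebra_simps power2_eq_square)
  qed
  moreover have "(\<Sum>i\<in>UNIV. ?G i q) = f q * ((\<Sum>i\<in>UNIV. V i q * pd i f q)
      - (\<Sum>i\<in>UNIV. k i * pd i (pd i f) q)) - (\<Sum>i\<in>UNIV. k i * (pd i f q)\<^sup>2)" for q
  proof -
    have "(\<Sum>i\<in>UNIV. ?G i q) = (\<Sum>i\<in>UNIV. pd i (V i) q) * (1/2 * (f q * f q))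
      + f q * (\<Sum>i\<in>UNIV. V i q * pd i f q) - (\<Sum>i\<in>UNIV. k i * (pd i f q)\<^sup>2)
      - f q * (\<Sum>i\<in>UNIV. k i * pd i (pd i f) q)"
      by (simp add: sum.distrib sum_subtractf sum_distrib_left sum_distrib_right algebra_simps)
    then show ?thesis by (simp add: V(2) algebra_simps)
  qed
  ultimately show ?thesis by simp
qed

lemma energy_rigidity:
  fixes f :: "'m \<Rightarrow> real^'n \<Rightarrow> real" and V :: "'n \<Rightarrow> real^'n \<Rightarrow> real"
  assumes f: "\<And>j. j \<in> J \<Longrightarrow> Ck_on 2 UNIV (f j)" "\<And>j. j \<in> J \<Longrightarrow> bounded {q. f j q \<noteq> 0}"
    and J: "finite J"
    and V: "\<And>i. Ck_on 2 UNIV (V i)" "\<And>q. (\<Sum>i\<in>UNIV. pd i (V i) q) = 0"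
    and k: "\<And>i. k i \<ge> 0" "k l > 0"
    and eq: "\<And>q. (\<Sum>j\<in>J. f j q * ((\<Sum>i\<in>UNIV. V i q * pd i (f j) q)
      - (\<Sum>i\<in>UNIV. k i * pd i (pd i (f j)) q))) = 0"
    and j: "j \<in> J"
  shows "f j q = 0"
proof -
  let ?D = "\<lambda>q. \<Sum>j\<in>J. \<Sum>i\<in>UNIV. k i * (pd i (f j) q)\<^sup>2"
  have "has_bochner_integral lborel (\<lambda>q. \<Sum>j\<in>J. f j q * ((\<Sum>i\<in>UNIV. V i q * pd i (f j) q)
      - (\<Sum>i\<in>UNIV. k i * pd i (pd i (f j)) q)) - (\<Sum>i\<in>UNIV. k i * (pd i (f j) q)\<^sup>2)) (\<Sum>j\<in>J. 0)"
    by (intro has_bochner_integral_sum energy_identity f V)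
  then have "has_bochner_integral lborel (\<lambda>q. - ?D q) 0"
    by (simp add: sum_subtractf eq)
  then have i: "has_bochner_integral lborel ?D 0"
    using has_bochner_integral_minus[of lborel "\<lambda>q. - ?D q" 0] by simp
  have "continuous_on UNIV ?D"
    by (intro continuous_intros Ck_on_2D(4) f)
  then have D0: "?D q = 0" for q
    by (rule integral_eq_0_imp_eq_0[OF _ _ i]) (intro sum_nonneg mult_nonneg_nonneg k zero_le_power2)
  have "pd l (f j) q = 0" for q
  proof -
    have "(\<Sum>i\<in>UNIV. k i * (pd i (f j) q)\<^sup>2) = 0"
      using D0[of q] j J by (subst (asm) sum_nonneg_eq_0_iff) (auto intro!: sum_nonneg simp: k)
    then have "k l * (pd l (f j) q)\<^sup>2 = 0"
      by (subst (asm) sum_nonneg_eq_0_iff) (auto simp: k)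
    then show ?thesis using k(2) by simp
  qed
  then have "has_pd l (f j) (\<lambda>_. 0)"
    using Ck_on_2D(1)[OF f(1)[OF j]] by (rule has_pd_cong[rotated])
  then show ?thesis by (rule pd_zero_imp_zero[OF f(2)[OF j]])
qed

text \<open>Testing the equation for V j against the coordinate q j gives the integral of the square of V j.\<close>
lemma inertial_rigidity:
  fixes V :: "'n::finite \<Rightarrow> real^'n \<Rightarrow> real"
  assumes V: "\<And>i. Ck_on 2 UNIV (V i)" "\<And>q. (\<Sum>i\<in>UNIV. pd i (V i) q) = 0"
    and b: "bounded {q. V j q \<noteq> 0}"
    and eq: "\<And>q. (\<Sum>i\<in>UNIV. V i q * pd i (V j) q) = 0"
  shows "V j q = 0"
proof -
  let ?F = "\<lambda>i q. q $ j * (V i q * V j q)"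
  let ?G = "\<lambda>i q. (if i = j then V i q * V j q else 0) + q $ j * (pd i (V i) q * V j q + V i q * pd i (V j) q)"
  note c = Ck_on_2D(3-4)[OF V(1)]
  have "has_bochner_integral lborel (\<lambda>q. \<Sum>i\<in>UNIV. ?G i q) 0"
  proof (rule divergence_integral_0[where F = ?F])
    show "continuous_on UNIV (?F i)" for i
      by (intro continuous_intros c)
    have "continuous_on UNIV (\<lambda>q. if i = j then V i q * V j q else 0)" for i
      by (cases "i = j") (simp_all add: continuous_on_mult c)
    then show "continuous_on UNIV (?G i)" for i
      by (intro continuous_intros c)
    show "bounded {q. ?F i q \<noteq> 0}" for i
      by (rule bounded_subset[OF b]) auto
    show "has_pd i (?F i) (?G i)" for i
      by (rule has_pd_cong, (rule has_pd_intros Ck_on_2D(1)[OF V(1)])+) simp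
  qed
  moreover have "(\<Sum>i\<in>UNIV. ?G i q) = (V j q)\<^sup>2" for q
  proof -
    have "(\<Sum>i\<in>UNIV. ?G i q) = (\<Sum>i\<in>UNIV. if i = j then V i q * V j q else 0)
       + q $ j * ((\<Sum>i\<in>UNIV. pd i (V i) q) * V j q + (\<Sum>i\<in>UNIV. V i q * pd i (V j) q))"
      by (simp add: sum.distrib sum_distrib_left sum_distrib_right algebra_simps)
    then show ?thesis by (simp add: V(2) eq power2_eq_square)
  qed
  ultimately have "has_bochner_integral lborel (\<lambda>q. (V j q)\<^sup>2) 0" by simp
  then have "(V j q)\<^sup>2 = 0"
    by (rule integral_eq_0_imp_eq_0[rotated 2]) (auto intro!: continuous_intros c)
  then show ?thesis by simp
qed

text \<open>The flux is the product of the derivative of f with d arctan (f / d).\<close>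
lemma gradient_concentration:
  fixes f :: "real^'n \<Rightarrow> real"
  assumes f: "Ck_on 2 UNIV f" "bounded {q. f q \<noteq> 0}" and d: "d > 0"
  shows "integrable lborel (\<lambda>q. (pd i f q)\<^sup>2 * (d\<^sup>2 / ((f q)\<^sup>2 + d\<^sup>2)))" (is "integrable _ ?I")
    and "(LINT q|lborel. (pd i f q)\<^sup>2 * (d\<^sup>2 / ((f q)\<^sup>2 + d\<^sup>2)))
      \<le> d * (pi / 2 * (LINT q|lborel. \<bar>pd i (pd i f) q\<bar>))"
proof -
  note c = Ck_on_2D(3-5)[OF f(1)]
  note b = pd_bounded_support[OF f(2)] pd_bounded_support[OF pd_bounded_support[OF f(2)]]
  have pos: "x\<^sup>2 + d\<^sup>2 > 0" for x using d by (simp add: add_nonneg_pos)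
  have nz: "x\<^sup>2 + d\<^sup>2 \<noteq> 0" for x using pos[of x] by (metis less_irrefl)
  \<comment> \<open>The derivative of \<open>?h\<close> has the value 1 at x = 0 and for small d
    concentrates there, while \<bar>?h\<bar> is at most d * pi / 2. Integration by parts therefore
    gives a bound of order d.\<close>
  let ?h = "\<lambda>x. d * arctan (x / d)"
  have h: "(?h has_real_derivative d\<^sup>2 / (x\<^sup>2 + d\<^sup>2)) (at x)" for x
  proof -
    have "(?h has_real_derivative d * (inverse (1 + (x / d)\<^sup>2) * (1 / d))) (at x)"
      using d by (intro DERIV_cmult DERIV_chain2[OF DERIV_arctan] DERIV_cdivide DERIV_ident)
    moreover have "d * (inverse (1 + (x / d)\<^sup>2) * (1 / d)) = d\<^sup>2 / (x\<^sup>2 + d\<^sup>2)"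
    proof -
      have "1 + (x / d)\<^sup>2 = (x\<^sup>2 + d\<^sup>2) / d\<^sup>2" using d by (simp add: field_simps)
      then show ?thesis using d by simp
    qed
    ultimately show ?thesis by simp
  qed
  let ?G = "\<lambda>q. pd i (pd i f) q * ?h (f q) + pd i f q * (d\<^sup>2 / ((f q)\<^sup>2 + d\<^sup>2) * pd i f q)"
  have G: "has_bochner_integral lborel ?G 0"
  proof (rule has_pd_integral_0[where F = "\<lambda>q. pd i f q * ?h (f q)"])
    show "continuous_on UNIV (\<lambda>q. pd i f q * ?h (f q))" "continuous_on UNIV ?G"
      using d nz by (auto intro!: continuous_intros c)
    show "bounded {q. pd i f q * ?h (f q) \<noteq> 0}"
      by (rule bounded_subset[OF b(1)]) auto
    show "has_pd i (\<lambda>q. pd i f q * ?h (f q)) ?G"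
      by (intro has_pd_mult has_pd_compose[where h = ?h and h' = "\<lambda>x. d\<^sup>2 / (x\<^sup>2 + d\<^sup>2)"] Ck_on_2D(1,2)[OF f(1)] h)
  qed
  show I: "integrable lborel ?I"
    by (rule integrable_continuous_bounded_support)
       (use nz in \<open>auto intro!: continuous_intros c intro: bounded_subset[OF b(1)]\<close>)
  have A: "integrable lborel (\<lambda>q. \<bar>pd i (pd i f) q\<bar>)"
    by (rule integrable_continuous_bounded_support) (auto intro!: continuous_intros c b)
  have "(LINT q|lborel. ?I q) \<le> (LINT q|lborel. ?G q + d * (pi / 2 * \<bar>pd i (pd i f) q\<bar>))"
  proof (rule integral_mono)
    show "integrable lborel (\<lambda>q. ?G q + d * (pi / 2 * \<bar>pd i (pd i f) q\<bar>))"
      using G A by (auto simp: has_bochner_integral_iff)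
    fix q
    have "\<bar>arctan (f q / d)\<bar> \<le> pi / 2" using arctan_bounded[of "f q / d"] by auto
    then have "\<bar>pd i (pd i f) q\<bar> * \<bar>arctan (f q / d)\<bar> \<le> \<bar>pd i (pd i f) q\<bar> * (pi / 2)"
      by (rule mult_left_mono) simp
    then have "- (pd i (pd i f) q * arctan (f q / d)) \<le> pi / 2 * \<bar>pd i (pd i f) q\<bar>"
      using abs_ge_minus_self[of "pd i (pd i f) q * arctan (f q / d)"]
      unfolding abs_mult by (simp only: mult.commute)
    from mult_left_mono[OF this, of d] d
    have "- (pd i (pd i f) q * ?h (f q)) \<le> d * (pi / 2 * \<bar>pd i (pd i f) q\<bar>)"
      by (simp add: algebra_simps)
    then show "?I q \<le> ?G q + d * (pi / 2 * \<bar>pd i (pd i f) q\<bar>)"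
      by (simp add: power2_eq_square algebra_simps)
  qed (rule I)
  also have "\<dots> = d * (pi / 2 * (LINT q|lborel. \<bar>pd i (pd i f) q\<bar>))"
    using G A by (auto simp: has_bochner_integral_iff)
  finally show "(LINT q|lborel. ?I q) \<le> d * (pi / 2 * (LINT q|lborel. \<bar>pd i (pd i f) q\<bar>))" .
qed

text \<open>The vectors a and b of the proof are the gradients of u - R y and v + R x, to which (u,
  v, w) is orthogonal by \<open>eu\<close> and \<open>ev\<close>. Their cross product N has third
  component R^2 + J. The first identity is the divergence theorem for z F(E) N with F(E) = E / (E +
  d^2); the second holds because J is a divergence.\<close>

lemma inertial_circles_identities:
  fixes u v w :: "real^3 \<Rightarrow> real" and R d :: real
  assumes C: "Ck_on 2 UNIV u" "Ck_on 2 UNIV v" and b: "bounded {q. u q \<noteq> 0}" "bounded {q. v q \<noteq> 0}"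
    and eu: "\<And>q. u q * pd 1 u q + v q * pd 2 u q + w q * pd 3 u q = R * v q"
    and ev: "\<And>q. u q * pd 1 v q + v q * pd 2 v q + w q * pd 3 v q = - R * u q"
    and d: "d > 0"
  defines "E \<equiv> \<lambda>q. u q * u q + v q * v q"
  defines "J \<equiv> \<lambda>q. R * (pd 1 v q - pd 2 u q) + (pd 1 u q * pd 2 v q - pd 2 u q * pd 1 v q)"
  shows "has_bochner_integral lborel (\<lambda>q. E q / (E q + d\<^sup>2) * (R\<^sup>2 + J q)) 0"
    and "has_bochner_integral lborel J 0"
proof -
  note c = Ck_on_2D(3-5)[OF C(1)] Ck_on_2D(3-5)[OF C(2)]
  note p = Ck_on_2D(1,2)[OF C(1)] Ck_on_2D(1,2)[OF C(2)]
  note sym = pd_commute[OF C(1), of 2 1] pd_commute[OF C(1), of 3 1] pd_commute[OF C(1), of 3 2]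
    pd_commute[OF C(2), of 2 1] pd_commute[OF C(2), of 3 1] pd_commute[OF C(2), of 3 2]
  have bE: "bounded {q. E q \<noteq> 0}"
    by (rule bounded_subset[OF bounded_Un[THEN iffD2, OF conjI[OF b]]]) (auto simp: E_def)
  define a1 a2 a3 b1 b2 b3 where "a1 = (\<lambda>q. pd 1 u q)" and "a2 = (\<lambda>q. pd 2 u q - R)" and "a3 = (\<lambda>q. pd 3 u q)"
    and "b1 = (\<lambda>q. pd 1 v q + R)" and "b2 = (\<lambda>q. pd 2 v q)" and "b3 = (\<lambda>q. pd 3 v q)"
  note ab = a1_def a2_def a3_def b1_def b2_def b3_def
  define N1 N2 N3 where "N1 = (\<lambda>q. a2 q * b3 q - a3 q * b2 q)" and "N2 = (\<lambda>q. a3 q * b1 q - a1 q * b3 q)"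
    and "N3 = (\<lambda>q. a1 q * b2 q - a2 q * b1 q)"
  define A where "A j i = pd j (pd i u)" for j i :: 3
  define B where "B j i = pd j (pd i v)" for j i :: 3
  define E' where "E' i q = 2 * (u q * pd i u q + v q * pd i v q)" for i q
  have pa: "has_pd j a1 (A j 1)" "has_pd j a2 (A j 2)" "has_pd j a3 (A j 3)"
    "has_pd j b1 (B j 1)" "has_pd j b2 (B j 2)" "has_pd j b3 (B j 3)" for j
    unfolding ab A_def B_def
    by (rule has_pd_cong, (rule has_pd_intros p)+, simp)+
  have ca: "continuous_on UNIV a1" "continuous_on UNIV a2" "continuous_on UNIV a3"
    "continuous_on UNIV b1" "continuous_on UNIV b2" "continuous_on UNIV b3"
    "continuous_on UNIV (A i j)" "continuous_on UNIV (B i j)" for i j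
    unfolding ab A_def B_def by (intro continuous_intros c)+
  define M1 M2 M3 where
    "M1 = (\<lambda>q. (A 1 2 q * b3 q + a2 q * B 1 3 q) - (A 1 3 q * b2 q + a3 q * B 1 2 q))" and
    "M2 = (\<lambda>q. (A 2 3 q * b1 q + a3 q * B 2 1 q) - (A 2 1 q * b3 q + a1 q * B 2 3 q))" and
    "M3 = (\<lambda>q. (A 3 1 q * b2 q + a1 q * B 3 2 q) - (A 3 2 q * b1 q + a2 q * B 3 1 q))"
  have pN: "has_pd 1 N1 M1" "has_pd 2 N2 M2" "has_pd 3 N3 M3"
    unfolding N1_def N2_def N3_def M1_def M2_def M3_def by (intro has_pd_diff has_pd_mult pa)+
  have cN: "continuous_on UNIV N1" "continuous_on UNIV N2" "continuous_on UNIV N3"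
    "continuous_on UNIV M1" "continuous_on UNIV M2" "continuous_on UNIV M3"
    unfolding N1_def N2_def N3_def M1_def M2_def M3_def by (intro continuous_intros ca)+
  \<comment> \<open>The divergence of a cross product of two gradients vanishes by symmetry of the
    second derivatives.\<close>
  have divN: "M1 q + M2 q + M3 q = 0" for q
    unfolding M1_def M2_def M3_def A_def B_def sym by (simp add: algebra_simps)
  have pE: "has_pd i E (E' i)" for i
    unfolding E_def E'_def by (rule has_pd_cong, (rule has_pd_intros p)+, simp add: algebra_simps)
  have cE: "continuous_on UNIV E" "continuous_on UNIV (E' i)" for i
    unfolding E_def E'_def by (intro continuous_intros c)+
  \<comment> \<open>Since grad u = a + R e_2, grad v = b - R e_1 and N is orthogonal to a and b, the
    left side is 2 R (u N_2 - v N_1). The bracket is the third component of X x (a x b) = a (X . b)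
    - b (X . a) = 0.\<close>
  have tangent: "E' 1 q * N1 q + E' 2 q * N2 q + E' 3 q * N3 q = 0" for q
  proof -
    have a: "u q * a1 q + v q * a2 q = - w q * a3 q" and b: "u q * b1 q + v q * b2 q = - w q * b3 q"
      using eu[of q] ev[of q] unfolding ab by (simp_all add: algebra_simps)
    have "E' 1 q * N1 q + E' 2 q * N2 q + E' 3 q * N3 q = 2 * R * (u q * N2 q - v q * N1 q)"
      unfolding E'_def N1_def N2_def N3_def ab by (simp add: algebra_simps)
    also have "u q * N2 q - v q * N1 q = a3 q * (u q * b1 q + v q * b2 q) - b3 q * (u q * a1 q + v q * a2 q)"
      unfolding N1_def N2_def by (simp add: algebra_simps)
    also have "\<dots> = 0" unfolding a b by simp
    finally show ?thesis by simp
  qed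
  let ?h = "\<lambda>x. x / (x + d\<^sup>2)" and ?h' = "\<lambda>x. d\<^sup>2 / (x + d\<^sup>2)\<^sup>2"
  have E0: "E q \<ge> 0" for q by (simp add: E_def)
  have pos: "E q + d\<^sup>2 > 0" for q using E0[of q] d by (simp add: add_nonneg_pos)
  have nz: "E q + d\<^sup>2 \<noteq> 0" for q using pos[of q] by (metis less_irrefl)
  have h: "(?h has_real_derivative ?h' (E q)) (at (E q))" for q
  proof -
    have "(?h has_real_derivative (1 * (E q + d\<^sup>2) - E q * (1 + 0)) / ((E q + d\<^sup>2) * (E q + d\<^sup>2))) (at (E q))"
      by (intro DERIV_divide DERIV_add DERIV_ident DERIV_const nz)
    then show ?thesis by (simp add: power2_eq_square)
  qed
  have ph: "has_pd i (\<lambda>q. ?h (E q)) (\<lambda>q. ?h' (E q) * E' i q)" for i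
    by (rule has_pd_compose[OF pE, where h = ?h and h' = ?h']) (rule h)
  have ch: "continuous_on UNIV (\<lambda>q. ?h (E q))" "continuous_on UNIV (\<lambda>q. ?h' (E q))"
    using nz by (auto intro!: continuous_intros cE)
  \<comment> \<open>The i-th term of div (z F(E) N), with z as the third coordinate. In the sum over
    i, \<open>tangent\<close> and \<open>divN\<close> remove everything except F(E) N_3, which comes
    from differentiating z.\<close>
  have flux: "has_bochner_integral lborel (\<lambda>q. (if i = 3 then 1 else 0) * (?h (E q) * N q)
      + q $ 3 * ((?h' (E q) * E' i q) * N q + ?h (E q) * M q)) 0"
    if "has_pd i N M" "continuous_on UNIV N" "continuous_on UNIV M" for i N M
  proof (rule has_pd_integral_0[where F = "\<lambda>q. q $ 3 * (?h (E q) * N q)"])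
    show "bounded {q. q $ 3 * (?h (E q) * N q) \<noteq> 0}"
      by (rule bounded_subset[OF bE]) auto
    show "continuous_on UNIV (\<lambda>q. q $ 3 * (?h (E q) * N q))"
      by (intro continuous_intros ch that)
    show "continuous_on UNIV (\<lambda>q. (if i = 3 then 1 else 0) * (?h (E q) * N q)
      + q $ 3 * ((?h' (E q) * E' i q) * N q + ?h (E q) * M q))"
      by (intro continuous_intros ch cE that)
    show "has_pd i (\<lambda>q. q $ 3 * (?h (E q) * N q)) (\<lambda>q. (if i = 3 then 1 else 0) * (?h (E q) * N q)
      + q $ 3 * ((?h' (E q) * E' i q) * N q + ?h (E q) * M q))"
      by (intro has_pd_mult ph that(1) has_pd_coord)
  qed
  have "q $ 3 * ((?h' (E q) * E' 1 q) * N1 q + ?h (E q) * M1 q) +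
      q $ 3 * ((?h' (E q) * E' 2 q) * N2 q + ?h (E q) * M2 q) +
      (?h (E q) * N3 q + q $ 3 * ((?h' (E q) * E' 3 q) * N3 q + ?h (E q) * M3 q))
      = ?h (E q) * (R\<^sup>2 + J q)" for q
  proof -
    have N3: "N3 q = R\<^sup>2 + J q"
      unfolding N3_def ab J_def by (simp add: algebra_simps power2_eq_square)
    have *: "x * ((k * e1) * n1 + y * m1) + x * ((k * e2) * n2 + y * m2) + (y * n3 + x * ((k * e3) * n3 + y * m3))
       = y * n3 + x * k * (e1 * n1 + e2 * n2 + e3 * n3) + x * y * (m1 + m2 + m3)"
      for x y k e1 e2 e3 n1 n2 n3 m1 m2 m3 :: real by (simp add: algebra_simps)
    show ?thesis unfolding * tangent divN unfolding N3 by simp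
  qed
  then show "has_bochner_integral lborel (\<lambda>q. E q / (E q + d\<^sup>2) * (R\<^sup>2 + J q)) 0"
    using has_bochner_integral_add[OF has_bochner_integral_add[OF flux[OF pN(1) cN(1,4)] flux[OF pN(2) cN(2,5)]] flux[OF pN(3) cN(3,6)]]
    by simp
  \<comment> \<open>J is the x-derivative of R v + u d_2 v minus the y-derivative of R u + u d_1 v;
    the mixed derivatives of v cancel.\<close>
  have "has_bochner_integral lborel (\<lambda>q. R * pd 1 v q + (pd 1 u q * pd 2 v q + u q * pd 1 (pd 2 v) q)) 0"
  proof (rule has_pd_integral_0[where F = "\<lambda>q. R * v q + u q * pd 2 v q"])
    show "bounded {q. R * v q + u q * pd 2 v q \<noteq> 0}"
      by (rule bounded_subset[OF bounded_Un[THEN iffD2, OF conjI[OF b]]]) auto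
    show "has_pd 1 (\<lambda>q. R * v q + u q * pd 2 v q) (\<lambda>q. R * pd 1 v q + (pd 1 u q * pd 2 v q + u q * pd 1 (pd 2 v) q))"
      by (rule has_pd_cong, (rule has_pd_intros p)+) simp
  qed (intro continuous_intros c)+
  moreover have "has_bochner_integral lborel (\<lambda>q. R * pd 2 u q + (pd 2 u q * pd 1 v q + u q * pd 2 (pd 1 v) q)) 0"
  proof (rule has_pd_integral_0[where F = "\<lambda>q. R * u q + u q * pd 1 v q"])
    show "bounded {q. R * u q + u q * pd 1 v q \<noteq> 0}"
      by (rule bounded_subset[OF b(1)]) auto
    show "has_pd 2 (\<lambda>q. R * u q + u q * pd 1 v q) (\<lambda>q. R * pd 2 u q + (pd 2 u q * pd 1 v q + u q * pd 2 (pd 1 v) q))"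
      by (rule has_pd_cong, (rule has_pd_intros p)+) simp
  qed (intro continuous_intros c)+
  ultimately have "has_bochner_integral lborel (\<lambda>q. (R * pd 1 v q + (pd 1 u q * pd 2 v q + u q * pd 1 (pd 2 v) q))
     - (R * pd 2 u q + (pd 2 u q * pd 1 v q + u q * pd 2 (pd 1 v) q))) (0 - 0)"
    by (rule has_bochner_integral_diff)
  moreover have "(R * pd 1 v q + (pd 1 u q * pd 2 v q + u q * pd 1 (pd 2 v) q))
     - (R * pd 2 u q + (pd 2 u q * pd 1 v q + u q * pd 2 (pd 1 v) q)) = J q" for q
    unfolding J_def sym by (simp add: algebra_simps)
  ultimately show "has_bochner_integral lborel J 0" by simp
qed

text \<open>Subtracting the two identities gives that R^2 times the integral of F d equals the
  integral of (1 - F d) J. The weight 1 - F d = d^2 / (E + d^2) concentrates where E = 0, and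
  \<open>gradient_concentration\<close> shows that squared first derivatives have little weighted
  mass there. So the right side tends to 0 with d.\<close>

lemma inertial_circles_rigidity:
  fixes u v w :: "real^3 \<Rightarrow> real" and R :: real
  assumes C: "Ck_on 2 UNIV u" "Ck_on 2 UNIV v" and b: "bounded {q. u q \<noteq> 0}" "bounded {q. v q \<noteq> 0}"
    and R: "R \<noteq> 0"
    and eu: "\<And>q. u q * pd 1 u q + v q * pd 2 u q + w q * pd 3 u q = R * v q"
    and ev: "\<And>q. u q * pd 1 v q + v q * pd 2 v q + w q * pd 3 v q = - R * u q"
  shows "u q = 0 \<and> v q = 0"
proof -
  define E where "E q = u q * u q + v q * v q" for q
  define J where "J q = R * (pd 1 v q - pd 2 u q) + (pd 1 u q * pd 2 v q - pd 2 u q * pd 1 v q)" for q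
  define F where "F d q = E q / (E q + d\<^sup>2)" for d q
  note c = Ck_on_2D(3-5)[OF C(1)] Ck_on_2D(3-5)[OF C(2)]
  have E0: "E q \<ge> 0" for q by (simp add: E_def)
  have bE: "bounded {q. E q \<noteq> 0}"
    by (rule bounded_subset[OF bounded_Un[THEN iffD2, OF conjI[OF b]]]) (auto simp: E_def)
  have cF: "continuous_on UNIV (F d)" if "d > 0" for d
  proof -
    have "E q + d\<^sup>2 \<noteq> 0" for q using E0[of q] that by (metis add_nonneg_pos less_irrefl zero_less_power)
    then show ?thesis unfolding F_def by (auto simp: E_def intro!: continuous_intros c)
  qed
  have iF: "integrable lborel (F d)" if "d > 0" for d
    by (rule integrable_continuous_bounded_support[OF cF[OF that] bounded_subset[OF bE]]) (auto simp: F_def)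
  have "bounded ({q. pd 1 u q \<noteq> 0} \<union> {q. pd 2 u q \<noteq> 0} \<union> {q. pd 1 v q \<noteq> 0} \<union> {q. pd 2 v q \<noteq> 0})"
    using b by (simp add: pd_bounded_support)
  then obtain r where r: "\<And>q. pd 1 u q \<noteq> 0 \<or> pd 2 u q \<noteq> 0 \<or> pd 1 v q \<noteq> 0 \<or> pd 2 v q \<noteq> 0 \<Longrightarrow> norm q \<le> r"
    unfolding bounded_iff by auto
  define K where "K = measure lborel (cball (0::real^3) r)"
  define D where "D i f = pi / 2 * (LINT q|lborel. \<bar>pd i (pd i f) q\<bar>)" for i :: 3 and f
  define S where "S = D 1 u + D 2 u + D 1 v + D 2 v"
  have D: "D i f \<ge> 0" for i f by (simp add: D_def)
  have main: "R\<^sup>2 * (LINT q|lborel. F 1 q) \<le> s * (2 * K + (R\<^sup>2 + 1) * S)" if s: "0 < s" "s \<le> 1" for s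
  proof -
    \<comment> \<open>Splitting the linear part of J costs s on a fixed ball and a factor R^2 / s on
      the squared gradients, whose weighted integrals are at most of order d. With d = s^2 both
      contributions are of order s.\<close>
    define d where "d = s\<^sup>2"
    have d: "d > 0" "d \<le> 1" using s by (auto simp: d_def power_le_one)
    have pos: "0 < E q + d\<^sup>2" for q using E0[of q] d by (simp add: add_nonneg_pos)
    define H where "H i f q = (pd i f q)\<^sup>2 * (d\<^sup>2 / ((f q)\<^sup>2 + d\<^sup>2))" for i :: 3 and f :: "real^3 \<Rightarrow> real" and q
    have H: "integrable lborel (H i u)" "integrable lborel (H i v)"
      "(LINT q|lborel. H i u q) \<le> d * D i u" "(LINT q|lborel. H i v q) \<le> d * D i v" for i
      unfolding H_def D_def using gradient_concentration[OF C(1) b(1) d(1)] gradient_concentration[OF C(2) b(2) d(1)] by auto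
    \<comment> \<open>A majorant of (1 - F d) J: the indicator accounts for the additive constants,
      as J vanishes off the ball of radius r.\<close>
    let ?W = "\<lambda>q. 2 * s * indicator (cball 0 r) q + (R\<^sup>2 / s + 1) * (H 1 u q + H 2 u q + H 1 v q + H 2 v q)"
    have iW: "integrable lborel ?W"
      by (intro Bochner_Integration.integrable_add integrable_mult_right H) (auto intro!: emeasure_compact_finite)
    have "has_bochner_integral lborel (\<lambda>q. F d q * (R\<^sup>2 + J q) - J q) (0 - 0)"
      using inertial_circles_identities[OF C b eu ev d(1)]
      unfolding E_def[symmetric] J_def[symmetric] F_def[symmetric] by (rule has_bochner_integral_diff)
    then have g: "integrable lborel (\<lambda>q. F d q * (R\<^sup>2 + J q) - J q)"
      "(LINT q|lborel. F d q * (R\<^sup>2 + J q) - J q) = 0"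
      by (simp_all add: has_bochner_integral_iff)
    have "R\<^sup>2 * (LINT q|lborel. F d q) = (LINT q|lborel. R\<^sup>2 * F d q - (F d q * (R\<^sup>2 + J q) - J q))"
      using g iF[OF d(1)] by simp
    also have "\<dots> \<le> (LINT q|lborel. ?W q)"
    proof (rule integral_mono)
      fix q
      let ?g = "d\<^sup>2 / (E q + d\<^sup>2)"
      have g: "0 \<le> ?g" "?g \<le> 1" using pos[of q] E0[of q] by (auto simp: field_simps)
      have F: "F d q = 1 - ?g" using pos[of q] by (simp add: F_def field_simps)
      \<comment> \<open>E dominates the squares of u and of v separately, so the weight in E is
        below each of the two weights to which \<open>gradient_concentration\<close>
        applies.\<close>
      have gu: "?g \<le> d\<^sup>2 / ((u q)\<^sup>2 + d\<^sup>2)" and gv: "?g \<le> d\<^sup>2 / ((v q)\<^sup>2 + d\<^sup>2)"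
        using d by (auto intro!: divide_left_mono mult_pos_pos add_nonneg_pos simp: E_def power2_eq_square)
      have Hg: "?g * (pd i u q)\<^sup>2 \<le> H i u q" "?g * (pd i v q)\<^sup>2 \<le> H i v q" for i
        using mult_left_mono[OF gu zero_le_power2[of "pd i u q"]] mult_left_mono[OF gv zero_le_power2[of "pd i v q"]]
        by (simp_all add: H_def mult.commute)
      have H0: "0 \<le> H i f q" for i f by (simp add: H_def)
      have "?g * J q \<le> ?W q"
      proof (cases "norm q \<le> r")
        case False
        then have "pd 1 u q = 0 \<and> pd 2 u q = 0 \<and> pd 1 v q = 0 \<and> pd 2 v q = 0"
          using r[of q] by blast
        then have "J q = 0" by (simp add: J_def)
        then show ?thesis using False s H0 by (auto intro!: mult_nonneg_nonneg add_nonneg_nonneg)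
      next
        case True
        let ?Q = "(pd 1 u q)\<^sup>2 + (pd 2 u q)\<^sup>2 + (pd 1 v q)\<^sup>2 + (pd 2 v q)\<^sup>2"
        \<comment> \<open>Used for the two terms of J linear in the gradient, with x = R and x = -
          R; the quadratic terms are handled by \<open>amgm\<close> at no cost in s.\<close>
        have young: "x * y \<le> s + x\<^sup>2 / s * y\<^sup>2" for x y
        proof -
          have "0 \<le> (s - x * y)\<^sup>2 + s\<^sup>2 + (x * y)\<^sup>2" by simp
          then have "s * (x * y) \<le> s\<^sup>2 + (x * y)\<^sup>2" by (simp add: power2_eq_square algebra_simps)
          then show ?thesis using s by (simp add: field_simps power2_eq_square)
        qed
        have amgm: "x * y \<le> x\<^sup>2 + y\<^sup>2" for x y :: real
          using zero_le_power2[of "x - y"] zero_le_power2[of x] zero_le_power2[of y]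
          unfolding power2_diff by linarith
        have "J q \<le> (s + R\<^sup>2 / s * (pd 1 v q)\<^sup>2) + (s + R\<^sup>2 / s * (pd 2 u q)\<^sup>2)
            + ((pd 1 u q)\<^sup>2 + (pd 2 v q)\<^sup>2) + ((pd 2 u q)\<^sup>2 + (pd 1 v q)\<^sup>2)"
          using young[of R "pd 1 v q"] young[of "- R" "pd 2 u q"] amgm[of "pd 1 u q" "pd 2 v q"]
            amgm[of "- pd 2 u q" "pd 1 v q"] unfolding J_def by (simp add: algebra_simps)
        also have "\<dots> \<le> 2 * s + (R\<^sup>2 / s + 1) * ?Q"
          using s by (simp add: algebra_simps add_nonneg_nonneg)
        finally have "?g * J q \<le> ?g * (2 * s + (R\<^sup>2 / s + 1) * ?Q)"
          by (rule mult_left_mono) (rule g)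
        also have "\<dots> = ?g * (2 * s) + (R\<^sup>2 / s + 1) * (?g * (pd 1 u q)\<^sup>2 + ?g * (pd 2 u q)\<^sup>2 + ?g * (pd 1 v q)\<^sup>2 + ?g * (pd 2 v q)\<^sup>2)"
          by (simp only: distrib_left mult.left_commute)
        also have "\<dots> \<le> 1 * (2 * s) + (R\<^sup>2 / s + 1) * (H 1 u q + H 2 u q + H 1 v q + H 2 v q)"
          by (intro add_mono mult_right_mono mult_left_mono Hg g) (use s in auto)
        finally show ?thesis using True by simp
      qed
      moreover have "R\<^sup>2 * (1 - x) - ((1 - x) * (R\<^sup>2 + J q) - J q) = x * J q" for x
        by (simp add: algebra_simps)
      ultimately show "R\<^sup>2 * F d q - (F d q * (R\<^sup>2 + J q) - J q) \<le> ?W q"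
        unfolding F by simp
    qed (use g iF[OF d(1)] iW in auto)
    also have "\<dots> = 2 * s * K + (R\<^sup>2 / s + 1) * ((LINT q|lborel. H 1 u q) + (LINT q|lborel. H 2 u q) + (LINT q|lborel. H 1 v q) + (LINT q|lborel. H 2 v q))"
    proof -
      have "integrable lborel (\<lambda>q::real^3. indicator (cball 0 r) q :: real)"
        by (auto intro!: emeasure_compact_finite)
      then show ?thesis by (simp add: H K_def)
    qed
    also have "\<dots> \<le> 2 * s * K + (R\<^sup>2 / s + 1) * (d * S)"
      using H(3)[of 1] H(3)[of 2] H(4)[of 1] H(4)[of 2] s
      by (intro add_left_mono mult_left_mono) (auto simp: S_def distrib_left)
    also have "(R\<^sup>2 / s + 1) * (d * S) = s * ((R\<^sup>2 + s) * S)"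
      using s by (simp add: d_def field_simps power2_eq_square)
    also have "2 * s * K + s * ((R\<^sup>2 + s) * S) \<le> 2 * s * K + s * ((R\<^sup>2 + 1) * S)"
      using s D by (intro add_left_mono mult_left_mono mult_right_mono) (auto simp: S_def)
    also have "\<dots> = s * (2 * K + (R\<^sup>2 + 1) * S)" by (simp add: algebra_simps)
    finally have "R\<^sup>2 * (LINT q|lborel. F d q) \<le> s * (2 * K + (R\<^sup>2 + 1) * S)" .
    \<comment> \<open>F d grows as d decreases, so the bound passes to the fixed function F 1 before
      s tends to 0.\<close>
    moreover have "(LINT q|lborel. F 1 q) \<le> (LINT q|lborel. F d q)"
    proof (rule integral_mono)
      fix q
      have "d\<^sup>2 \<le> 1" using d by (simp add: power_le_one)
      then show "F 1 q \<le> F d q"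
        unfolding F_def using pos[of q] E0[of q] by (intro divide_left_mono) (auto intro!: mult_pos_pos)
    qed (use iF d in auto)
    then have "R\<^sup>2 * (LINT q|lborel. F 1 q) \<le> R\<^sup>2 * (LINT q|lborel. F d q)"
      by (rule mult_left_mono) simp
    ultimately show ?thesis by linarith
  qed
  have F0: "0 \<le> F 1 q" for q using E0[of q] by (simp add: F_def)
  have "R\<^sup>2 * (LINT q|lborel. F 1 q) \<le> 0"
  proof (rule tendsto_lowerbound[where f = "\<lambda>s. s * (2 * K + (R\<^sup>2 + 1) * S)" and F = "at_right 0"])
    have "((\<lambda>s. s * (2 * K + (R\<^sup>2 + 1) * S)) \<longlongrightarrow> 0 * (2 * K + (R\<^sup>2 + 1) * S)) (at_right 0)"
      by (intro tendsto_intros)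
    then show "((\<lambda>s. s * (2 * K + (R\<^sup>2 + 1) * S)) \<longlongrightarrow> 0) (at_right 0)" by simp
    show "\<forall>\<^sub>F s in at_right 0. R\<^sup>2 * (LINT q|lborel. F 1 q) \<le> s * (2 * K + (R\<^sup>2 + 1) * S)"
      unfolding eventually_at_right_field by (intro exI[of _ 1]) (auto intro: main)
  qed auto
  then have "(LINT q|lborel. F 1 q) \<le> 0" using R by (simp add: mult_le_0_iff)
  moreover have "(LINT q|lborel. F 1 q) \<ge> 0" by (rule Bochner_Integration.integral_nonneg) (rule F0)
  ultimately have "has_bochner_integral lborel (F 1) 0"
    using iF[of 1] by (simp add: has_bochner_integral_iff)
  then have "F 1 q = 0"
    by (rule integral_eq_0_imp_eq_0[rotated 2]) (use cF F0 in auto)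
  then have "E q = 0" using E0[of q] by (simp add: F_def add_nonneg_eq_0_iff)
  then show ?thesis by (simp add: E_def add_nonneg_eq_0_iff)
qed


section \<open>The exterior of the support and the theorem\<close>

lemma affine_along_axis:
  fixes f :: "real^'n \<Rightarrow> real"
  assumes f: "f differentiable_on S" and I: "convex I" "s \<in> I" "t \<in> I"
    and d: "\<And>r. r \<in> I \<Longrightarrow> q + r *\<^sub>R axis i 1 \<in> interior S \<and> partial S i f (q + r *\<^sub>R axis i 1) = m"
  shows "f (q + s *\<^sub>R axis i 1) = f (q + t *\<^sub>R axis i 1) + m * (s - t)"
proof -
  have "((\<lambda>r. f (q + r *\<^sub>R axis i 1) - m * r) has_real_derivative 0) (at r within I)" if "r \<in> I" for r
  proof -
    have "((\<lambda>r. f (q + r *\<^sub>R axis i 1)) has_real_derivative m) (at r)"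
      using has_partial_line[OF f] d[OF that] by metis
    then have "((\<lambda>r. f (q + r *\<^sub>R axis i 1) - m * r) has_real_derivative m - m * 1) (at r)"
      by (intro DERIV_diff DERIV_cmult DERIV_ident)
    then show ?thesis by (simp add: has_field_derivative_at_within)
  qed
  from has_field_derivative_zero_constant[OF I(1) this]
  obtain c where "\<forall>r\<in>I. f (q + r *\<^sub>R axis i 1) - m * r = c" by auto
  then have "f (q + s *\<^sub>R axis i 1) - m * s = f (q + t *\<^sub>R axis i 1) - m * t" using I by simp
  then show ?thesis by (simp add: algebra_simps)
qed

text \<open>Reads a partial derivative off the values of f on the part of the line inside A, whose
  parameters form an open set containing 0. Off A nothing is known about f.\<close>

lemma partial_eqI:
  fixes f :: "real^'n \<Rightarrow> real"
  assumes f: "f differentiable_on S" and A: "open A" "A \<subseteq> S" "q \<in> A"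
    and g: "(g has_real_derivative D) (at 0)" and eq: "\<And>t. q + t *\<^sub>R axis i 1 \<in> A \<Longrightarrow> f (q + t *\<^sub>R axis i 1) = g t"
  shows "partial S i f q = D"
proof -
  have q: "q \<in> interior S" using A interior_maximal by blast
  have "((\<lambda>t. f (q + t *\<^sub>R axis i 1)) has_real_derivative partial S i f q) (at 0)"
    using has_partial_line[OF f, of q 0 i] q by simp
  moreover have "open ((\<lambda>t. q + t *\<^sub>R axis i (1::real)) -` A)"
    by (rule open_vimage[OF A(1)]) (intro continuous_intros)
  then have "((\<lambda>t. f (q + t *\<^sub>R axis i 1)) has_real_derivative D) (at 0)"
    by (rule has_field_derivative_transform_within_open[OF g]) (use A(3) eq in auto)
  ultimately show ?thesis by (rule DERIV_unique)
qed

lemma open_channel: "open (channel L)"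
  unfolding channel_def by (intro open_Collect_conj open_Collect_less continuous_intros)

lemma convex_between: "convex {r::real. min x y \<le> r \<and> r \<le> max x y}"
proof -
  have "{r. min x y \<le> r \<and> r \<le> max x y} = {min x y..max x y}" by auto
  then show ?thesis by simp
qed

text \<open>The exterior of the box is connected through the column over (M + 1, 0), on which the
  temperature equation reduces to an ordinary differential equation.\<close>
lemma exterior_rest_state:
  fixes p T :: "real^3 \<Rightarrow> real" and L M e :: real
  defines "S \<equiv> closure (channel L)"
  defines "U \<equiv> {q \<in> channel L. \<not> (\<bar>q $ 1\<bar> \<le> M \<and> \<bar>q $ 2\<bar> \<le> M \<and> e \<le> q $ 3 \<and> q $ 3 \<le> L - e)}"
  assumes L: "L > 0" and M: "M \<ge> 0"
    and p: "p differentiable_on S" and T: "T differentiable_on S" and T3: "partial S 3 T differentiable_on S"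
    and p12: "\<And>q. q \<in> U \<Longrightarrow> partial S 1 p q = 0" "\<And>q. q \<in> U \<Longrightarrow> partial S 2 p q = 0"
    and hyd: "\<And>q. q \<in> U \<Longrightarrow> partial S 3 p q + T q = 0"
    and heat: "\<And>q. q \<in> U \<Longrightarrow> \<kappa>\<^sub>H * laplacian_H S T q + \<kappa>\<^sub>3 * partial S 3 (partial S 3 T) q = 0"
    and k3: "\<kappa>\<^sub>3 \<noteq> 0"
    and neumann: "\<And>q. q $ 3 = 0 \<Longrightarrow> partial S 3 T q = 0"
  obtains a b where "\<And>q. q \<in> U \<Longrightarrow> T q = a" "\<And>q. q \<in> U \<Longrightarrow> p q = - a * q $ 3 + b"
proof -
  define pt :: "real \<Rightarrow> real \<Rightarrow> real \<Rightarrow> real^3" where "pt x y z = vector [x, y, z]" for x y z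
  have pt: "pt x y z $ 1 = x" "pt x y z $ 2 = y" "pt x y z $ 3 = z" for x y z
    by (simp_all add: pt_def)
  have pt_eq: "q = pt (q $ 1) (q $ 2) (q $ 3)" for q
    by (simp add: vec_eq_iff forall_3 pt)
  have ax: "(axis i (1::real) :: real^3) $ j = (if j = i then 1 else 0)" for i j
    by (simp add: axis_def)
  have shift: "pt x y z + t *\<^sub>R axis 1 1 = pt (x + t) y z" "pt x y z + t *\<^sub>R axis 2 1 = pt x (y + t) z"
    "pt x y z + t *\<^sub>R axis 3 1 = pt x y (z + t)" for x y z t
    by (simp_all add: vec_eq_iff forall_3 pt ax)
  have "closed {q::real^3. \<bar>q $ 1\<bar> \<le> M \<and> \<bar>q $ 2\<bar> \<le> M \<and> e \<le> q $ 3 \<and> q $ 3 \<le> L - e}"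
    by (intro closed_Collect_conj closed_Collect_le continuous_intros)
  moreover have "U = channel L - {q::real^3. \<bar>q $ 1\<bar> \<le> M \<and> \<bar>q $ 2\<bar> \<le> M \<and> e \<le> q $ 3 \<and> q $ 3 \<le> L - e}"
    by (auto simp: U_def)
  ultimately have oU: "open U" using open_channel by (simp add: open_Diff)
  have US: "U \<subseteq> S" using closure_subset by (auto simp: U_def S_def)
  then have Ui: "q \<in> interior S" if "q \<in> U" for q using that oU interior_maximal by blast
  have ptU: "pt x y z \<in> U \<longleftrightarrow> 0 < z \<and> z < L \<and> \<not> (\<bar>x\<bar> \<le> M \<and> \<bar>y\<bar> \<le> M \<and> e \<le> z \<and> z \<le> L - e)" for x y z
    by (simp add: U_def channel_def pt)
  have mx: "p (pt x y z) = p (pt x' y z)"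
    if "\<And>s. min x x' \<le> s \<Longrightarrow> s \<le> max x x' \<Longrightarrow> pt s y z \<in> U" for x x' y z
    using affine_along_axis[OF p convex_between[of x x'], of x x' "pt 0 y z" 1 0] that p12(1) Ui
    by (simp add: shift)
  have my: "p (pt x y z) = p (pt x y' z)"
    if "\<And>s. min y y' \<le> s \<Longrightarrow> s \<le> max y y' \<Longrightarrow> pt x s z \<in> U" for x y y' z
    using affine_along_axis[OF p convex_between[of y y'], of y y' "pt x 0 z" 2 0] that p12(2) Ui
    by (simp add: shift)
  \<comment> \<open>A vertical column beside the box: it stays in U at every height of the channel
    and serves as the common reference.\<close>
  define col where "col z = pt (M + 1) 0 z" for z
  have colU: "col z \<in> U \<longleftrightarrow> 0 < z \<and> z < L" for z
    using M by (simp add: col_def ptU)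
  have colS: "col z \<in> S" if "0 \<le> z" "z \<le> L" for z
    unfolding S_def closure_channel[OF L] col_def using that by (simp add: pt)
  have P: "p (pt x y z) = p (col z)" if q: "pt x y z \<in> U" for x y z
  proof -
    have z: "0 < z" "z < L" using q by (simp_all add: ptU)
    consider "z < e \<or> z > L - e" | "x > M" | "\<bar>y\<bar> > M" | "x < - M" using q by (force simp: ptU)
    then show ?thesis
    proof cases
      case 1
      have "p (pt x y z) = p (pt (M + 1) y z)" by (rule mx) (use 1 z in \<open>auto simp: ptU\<close>)
      also have "\<dots> = p (pt (M + 1) 0 z)" by (rule my) (use 1 z in \<open>auto simp: ptU\<close>)
      finally show ?thesis by (simp add: col_def)
    next
      case 2
      have "p (pt x y z) = p (pt x 0 z)" by (rule my) (use 2 z in \<open>auto simp: ptU\<close>)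
      also have "\<dots> = p (pt (M + 1) 0 z)" by (rule mx) (use 2 z in \<open>auto simp: ptU\<close>)
      finally show ?thesis by (simp add: col_def)
    next
      case 3
      have "p (pt x y z) = p (pt (M + 1) y z)" by (rule mx) (use 3 z in \<open>auto simp: ptU\<close>)
      also have "\<dots> = p (pt (M + 1) 0 z)" by (rule my) (use M z in \<open>auto simp: ptU\<close>)
      finally show ?thesis by (simp add: col_def)
    next
      \<comment> \<open>The box may lie between the point and the column, so the path goes around it
        along y = M + 1.\<close>
      case 4
      have "p (pt x y z) = p (pt x (M + 1) z)" by (rule my) (use 4 z in \<open>auto simp: ptU\<close>)
      also have "\<dots> = p (pt (M + 1) (M + 1) z)" by (rule mx) (use M z in \<open>auto simp: ptU\<close>)
      also have "\<dots> = p (pt (M + 1) 0 z)" by (rule my) (use M z in \<open>auto simp: ptU\<close>)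
      finally show ?thesis by (simp add: col_def)
    qed
  qed
  then have Pq: "p q = p (col (q $ 3))" if "q \<in> U" for q
    using that pt_eq[of q] by metis
  \<comment> \<open>By hydrostatic balance T = - d_3 p on U, and there p depends on the height only,
    hence so does its vertical derivative.\<close>
  have Tq: "T q = T (col (q $ 3))" if q: "q \<in> U" for q
  proof -
    have c: "col (q $ 3) \<in> U" unfolding colU using q by (simp add: U_def channel_def)
    have "partial S 3 p q = partial S 3 p (col (q $ 3))"
    proof (rule partial_eqI[OF p oU US q])
      show "((\<lambda>t. p (col (q $ 3) + t *\<^sub>R axis 3 1)) has_real_derivative partial S 3 p (col (q $ 3))) (at 0)"
        using has_partial_line[OF p, of "col (q $ 3)" 0 3] Ui[OF c] by simp
      show "p (q + t *\<^sub>R axis 3 1) = p (col (q $ 3) + t *\<^sub>R axis 3 1)" if "q + t *\<^sub>R axis 3 1 \<in> U" for t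
        using Pq[OF that] by (simp add: col_def shift ax)
    qed
    then show ?thesis using hyd[OF q] hyd[OF c] by simp
  qed
  have T1: "partial S 1 T q = 0" and T2: "partial S 2 T q = 0" if "q \<in> U" for q
    by (rule partial_eqI[OF T oU US that, of "\<lambda>_. T (col (q $ 3))"], simp, simp add: Tq ax)+
  have T33: "partial S 3 (partial S 3 T) q = 0" if q: "q \<in> U" for q
  proof -
    have "partial S 1 (partial S 1 T) q = 0" "partial S 2 (partial S 2 T) q = 0"
      using partial_eq_0_open[OF oU US q, of _ 0] T1 T2 by auto
    then show ?thesis using heat[OF q] k3 by (simp add: laplacian_H_def)
  qed
  \<comment> \<open>By \<open>T33\<close> the vertical derivative of T is constant along the open
    column; its continuity up to the wall z = 0 carries the Neumann value 0 inside.\<close>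
  have T30: "partial S 3 T (col z) = 0" if z: "0 < z" "z < L" for z
  proof -
    have "partial S 3 T (col z) = partial S 3 T (col 0)"
    proof (rule DERIV_isconst_end[OF z(1)])
      have "continuous_on S (partial S 3 T)" by (rule differentiable_imp_continuous_on[OF T3])
      then show "continuous_on {0..z} (\<lambda>z. partial S 3 T (col z))"
      proof (rule continuous_on_compose2)
        have "continuous_on {0..z} (\<lambda>z. col 0 + z *\<^sub>R axis 3 1)" by (intro continuous_intros)
        then show "continuous_on {0..z} col" by (simp add: col_def shift)
        show "col ` {0..z} \<subseteq> S" using colS z by auto
      qed
      show "((\<lambda>z. partial S 3 T (col z)) has_real_derivative 0) (at s)" if "0 < s" "s < z" for s
      proof -
        have "col 0 + s *\<^sub>R axis 3 1 \<in> U" using that z by (simp add: col_def shift ptU M)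
        from has_partial_line[OF T3 Ui[OF this]] T33[OF this]
        show ?thesis by (simp add: col_def shift)
      qed
    qed
    also have "\<dots> = 0" by (rule neumann) (simp add: col_def pt)
    finally show ?thesis .
  qed
  define a where "a = T (col (L / 2))"
  define b where "b = p (col (L / 2)) + a * (L / 2)"
  have cU: "col 0 + r *\<^sub>R axis 3 1 = col r" for r by (simp add: col_def shift)
  have Ta: "T (col z) = a" if z: "0 < z" "z < L" for z
    using affine_along_axis[OF T convex_real_interval(8)[of 0 L], of z "L / 2" "col 0" 3 0] z L T30 Ui colU
    by (simp add: cU a_def)
  have pa: "p (col z) = - a * z + b" if z: "0 < z" "z < L" for z
  proof -
    have "partial S 3 p (col r) = - a" if "0 < r" "r < L" for r
      using hyd[of "col r"] Ta[OF that] colU[of r] that by simp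
    then show ?thesis
      using affine_along_axis[OF p convex_real_interval(8)[of 0 L], of z "L / 2" "col 0" 3 "- a"] z L Ui colU
      by (simp add: cU b_def algebra_simps)
  qed
  show ?thesis
    by (rule that[of a b]) (use Tq Pq Ta pa in \<open>auto simp: U_def channel_def\<close>)
qed

section \<open>From the exterior to the whole channel\<close>

lemma partial_diff_const: "partial S i (\<lambda>q. f q - c) = partial S i f"
proof -
  have "((\<lambda>q. f q - c) has_derivative D) (at q within S) \<longleftrightarrow> (f has_derivative D) (at q within S)" for D q
    using has_derivative_diff[of f D "at q within S" "\<lambda>_. c" "\<lambda>_. 0"]
      has_derivative_add[of "\<lambda>q. f q - c" D "at q within S" "\<lambda>_. c" "\<lambda>_. 0"] by auto
  then show ?thesis by (simp add: partial_def frechet_derivative_def fun_eq_iff)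
qed

lemma Ck_on_diff_const: "Ck_on k S f \<Longrightarrow> Ck_on k S (\<lambda>q. f q - c)"
  by (cases k) (auto simp: partial_diff_const intro!: continuous_intros derivative_intros differentiable_on_diff)

theorem theorem1:
  fixes L \<kappa>\<^sub>H \<kappa>\<^sub>3 \<nu>\<^sub>H \<nu>\<^sub>3 R :: real
    and X :: "real^3 \<Rightarrow> real^3"
    and p T :: "real^3 \<Rightarrow> real"
    and \<Omega> S :: "(real^3) set"
    and u v w :: "real^3 \<Rightarrow> real"
  assumes "L > 0"
    and "\<kappa>\<^sub>H > 0" and "\<kappa>\<^sub>3 > 0" and "\<nu>\<^sub>H \<ge> 0" and "\<nu>\<^sub>3 \<ge> 0"
    and "\<Omega> = channel L" and "S = closure \<Omega>"
    and "u = (\<lambda>q. X q $ 1)" and "v = (\<lambda>q. X q $ 2)" and "w = (\<lambda>q. X q $ 3)"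
    and "smooth_on S X" and "smooth_on S p" and "smooth_on S T"
    and "\<forall>q\<in>\<Omega>. advect S X u q + partial S 1 p q - R * v q
           = \<nu>\<^sub>H * laplacian_H S u q + \<nu>\<^sub>3 * partial S 3 (partial S 3 u) q"
    and "\<forall>q\<in>\<Omega>. advect S X v q + partial S 2 p q + R * u q
           = \<nu>\<^sub>H * laplacian_H S v q + \<nu>\<^sub>3 * partial S 3 (partial S 3 v) q"
    and "\<forall>q\<in>\<Omega>. partial S 3 p q + T q = 0"
    and "\<forall>q\<in>\<Omega>. advect S X T q
           = \<kappa>\<^sub>H * laplacian_H S T q + \<kappa>\<^sub>3 * partial S 3 (partial S 3 T) q"
    and "\<forall>q\<in>\<Omega>. divergence S X q = 0"
    and "\<forall>q. q $ 3 = 0 \<or> q $ 3 = L \<longrightarrow> w q = 0"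
    and "\<forall>q. q $ 3 = 0 \<or> q $ 3 = L \<longrightarrow> partial S 3 T q = 0"
    and "compact (closure {q \<in> S. X q \<noteq> 0})"
    and "closure {q \<in> S. X q \<noteq> 0} \<subseteq> \<Omega>"
  shows "(\<forall>q\<in>\<Omega>. X q = 0) \<and> (\<exists>a b. \<forall>q\<in>\<Omega>. p q = - a * q $ 3 + b \<and> T q = a)"
proof -
  note L = assms(1) and \<Omega> = assms(6) and S = assms(7)[unfolded assms(6)]
  let ?C = "channel L"
  note uvw = assms(8-10)
  have S3: "S = {q. 0 \<le> q $ 3 \<and> q $ 3 \<le> L}" unfolding S by (rule closure_channel[OF L])
  have CS: "?C \<subseteq> S" by (auto simp: S3 channel_def)
  then have Ci: "q \<in> interior S" if "q \<in> ?C" for q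
    using that open_channel interior_maximal by blast
  define K where "K = closure {q \<in> S. X q \<noteq> 0}"
  have K: "compact K" "closed K" "K \<subseteq> ?C"
    using assms(21,22) by (auto simp: K_def \<Omega>)
  have X0: "X q = 0" if "q \<in> ?C - K" for q
    using that CS closure_subset[of "{q \<in> S. X q \<noteq> 0}"] by (auto simp: K_def)
  have Ck: "Ck_on k S X" "Ck_on k S p" "Ck_on k S T" for k
    using assms(11-13) by (auto simp: smooth_on_def)
  have d1: "p differentiable_on S" "T differentiable_on S" "partial S i T differentiable_on S" for i
    using Ck(2)[of 1] Ck(3)[of 2] by (auto simp: numeral_2_eq_2)

  obtain e where e: "e > 0" "(\<Union>q\<in>K. ball q e) \<subseteq> ?C"
    using compact_subset_open_imp_ball_epsilon_subset[OF K(1) open_channel K(3)] by blast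
  obtain M where M: "M > 0" "\<And>q. q \<in> K \<Longrightarrow> norm q \<le> M"
    using compact_imp_bounded[OF K(1)] unfolding bounded_pos by auto
  \<comment> \<open>The support K is replaced by a box that keeps the distance e from both walls. In
    its complement, points of equal height can be joined by explicit coordinate segments.\<close>
  define B where "B = {q::real^3. \<bar>q $ 1\<bar> \<le> M \<and> \<bar>q $ 2\<bar> \<le> M \<and> e \<le> q $ 3 \<and> q $ 3 \<le> L - e}"
  have B: "closed B" "B \<subseteq> ?C"
  proof -
    show "closed B"
      unfolding B_def by (intro closed_Collect_conj closed_Collect_le continuous_intros)
    show "B \<subseteq> ?C"
    proof
      fix q assume "q \<in> B"
      then show "q \<in> ?C" using e(1) by (simp add: B_def channel_def)
    qed
  qed
  have bB: "bounded B"
  proof (rule bounded_subset[OF bounded_cball])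
    show "B \<subseteq> cball 0 (M + M + L)"
    proof
      fix q assume "q \<in> B"
      then have "(\<Sum>i\<in>UNIV. \<bar>q $ i\<bar>) \<le> M + M + L"
        using e(1) by (simp add: sum_3 B_def)
      then show "q \<in> cball 0 (M + M + L)" using norm_le_l1_cart[of q] by simp
    qed
  qed
  have KB: "K \<subseteq> B"
  proof
    fix q assume q: "q \<in> K"
    \<comment> \<open>A vertical move by less than e stays in the channel. Were q closer than e to a
      wall, moving by exactly that distance would reach the wall, a contradiction.\<close>
    have vert: "0 < q $ 3 + t \<and> q $ 3 + t < L" if "\<bar>t\<bar> < e" for t
    proof -
      have "q + t *\<^sub>R axis 3 1 \<in> ball q e" using that by (simp add: dist_norm)
      then have "q + t *\<^sub>R axis 3 1 \<in> ?C" using e(2) q by blast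
      then show ?thesis by (simp add: channel_def)
    qed
    have q3: "0 < q $ 3" "q $ 3 < L" using vert[of 0] e(1) by simp_all
    have "e \<le> q $ 3"
      using vert[of "- q $ 3"] q3 by (cases "q $ 3 < e") simp_all
    moreover have "q $ 3 \<le> L - e"
      using vert[of "L - q $ 3"] q3 by (cases "L - q $ 3 < e") simp_all
    ultimately show "q \<in> B"
      using M(2)[OF q] component_le_norm_cart[of q 1] component_le_norm_cart[of q 2] by (simp add: B_def)
  qed
  define U where "U = ?C - B"
  have U': "U = {q \<in> channel L. \<not> (\<bar>q $ 1\<bar> \<le> M \<and> \<bar>q $ 2\<bar> \<le> M \<and> e \<le> q $ 3 \<and> q $ 3 \<le> L - e)}"
    by (auto simp: U_def B_def)
  have oCK: "open (?C - K)" using open_channel K(2) by (rule open_Diff)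
  have z1: "partial S i (\<lambda>q. X q $ j) q = 0" if "q \<in> ?C - K" for i j q
    by (rule partial_eq_0_open[OF oCK _ that, of _ _ 0]) (use CS X0 in auto)
  have z2: "partial S i (partial S l (\<lambda>q. X q $ j)) q = 0" if "q \<in> ?C - K" for i j l q
    by (rule partial_eq_0_open[OF oCK _ that, of _ _ 0]) (use CS z1 in auto)
  have UK: "U \<subseteq> ?C - K" using KB by (auto simp: U_def)

  \<comment> \<open>Outside the box X and its derivatives vanish, so the momentum equations say that
    p has no horizontal gradient and the temperature equation loses its advection term.\<close>
  obtain a b where ab: "\<And>q. q \<in> U \<Longrightarrow> T q = a" "\<And>q. q \<in> U \<Longrightarrow> p q = - a * q $ 3 + b"
  proof (rule exterior_rest_state[of L M p T e \<kappa>\<^sub>H \<kappa>\<^sub>3, folded U' S, OF L _ d1(1,2) d1(3)])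
    fix q assume q: "q \<in> U"
    then have q': "q \<in> ?C" "X q = 0" "q \<in> ?C - K" using UK X0 by auto
    show "partial S 1 p q = 0" "partial S 2 p q = 0"
      using assms(14,15) q' z1[OF q'(3)] z2[OF q'(3)]
      by (auto simp: \<Omega> uvw advect_def laplacian_H_def)
    show "partial S 3 p q + T q = 0" using assms(16) q' by (simp add: \<Omega>)
    show "\<kappa>\<^sub>H * laplacian_H S T q + \<kappa>\<^sub>3 * partial S 3 (partial S 3 T) q = 0"
      using assms(17) q' by (auto simp: \<Omega> advect_def)
  qed (use M assms(3,20) in auto)

  \<comment> \<open>Extension of the velocity by zero: it is C^2 on the whole space and obeys the
    same equations there, so no boundary terms arise.\<close>
  define V where "V i q = (if q \<in> ?C then X q $ i else 0)" for i q
  have CV: "Ck_on 2 UNIV (V i)" for i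
  proof -
    have "Ck_on 2 UNIV (\<lambda>q. if q \<in> ?C then X q else 0)"
      by (rule Ck_on_extend_const[OF open_channel K(2,3) CS Ck(1)]) (rule X0)
    then have "Ck_on 2 UNIV (\<lambda>q. (if q \<in> ?C then X q else 0) $ i)" by (rule Ck_on_component)
    moreover have "(\<lambda>q. (if q \<in> ?C then X q else 0) $ i) = V i" by (auto simp: V_def)
    ultimately show ?thesis by simp
  qed
  have bV: "bounded {q. V i q \<noteq> 0}" for i
  proof (rule bounded_subset[OF bB], rule subsetI)
    fix q assume "q \<in> {q. V i q \<noteq> 0}"
    then have "q \<in> ?C" "X q \<noteq> 0" by (auto simp: V_def split: if_splits)
    then show "q \<in> B" using X0[of q] KB by blast
  qed
  have V1: "pd i (V j) = (\<lambda>q. if q \<in> ?C then partial S i (\<lambda>q. X q $ j) q else 0)" for i j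
    unfolding V_def by (rule partial_extend_const[OF open_channel K(2,3) CS]) (simp add: X0)
  have V2: "pd l (pd i (V j)) = (\<lambda>q. if q \<in> ?C then partial S l (partial S i (\<lambda>q. X q $ j)) q else 0)" for i j l
    unfolding V1 by (rule partial_extend_const[OF open_channel K(2,3) CS]) (rule z1)
  have divV: "(\<Sum>i\<in>UNIV. pd i (V i) q) = 0" for q
    using assms(18) by (simp add: sum_3 V1 divergence_def \<Omega>)

  \<comment> \<open>T itself need not have bounded support, but T - a vanishes outside the box and
    extends by zero. The energy argument for this single scalar then uses the conductivities as
    coefficients.\<close>
  define \<theta> where "\<theta> q = (if q \<in> ?C then T q - a else 0)" for q
  have T0: "T q - a = 0" if "q \<in> ?C - B" for q using ab(1) that by (simp add: U_def)
  have C\<theta>: "Ck_on 2 UNIV \<theta>"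
    unfolding \<theta>_def by (rule Ck_on_extend_const[OF open_channel B CS Ck_on_diff_const[OF Ck(3)]]) (rule T0)
  have b\<theta>: "bounded {q. \<theta> q \<noteq> 0}"
  proof (rule bounded_subset[OF bB], rule subsetI)
    fix q assume "q \<in> {q. \<theta> q \<noteq> 0}"
    then have "q \<in> ?C" "T q - a \<noteq> 0" by (auto simp: \<theta>_def split: if_splits)
    then show "q \<in> B" using T0[of q] by blast
  qed
  have \<theta>1: "pd i \<theta> = (\<lambda>q. if q \<in> ?C then partial S i T q else 0)" for i
  proof -
    have "pd i \<theta> = (\<lambda>q. if q \<in> ?C then partial S i (\<lambda>q. T q - a) q else 0)"
      unfolding \<theta>_def by (rule partial_extend_const[OF open_channel B CS]) (rule T0)
    then show ?thesis by (simp only: partial_diff_const)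
  qed
  have oU: "open U" unfolding U_def using open_channel B(1) by (rule open_Diff)
  have zT: "partial S i T q = 0" if "q \<in> ?C - B" for i q
    by (rule partial_eq_0_open[OF oU, of _ _ _ a]) (use that ab(1) CS in \<open>auto simp: U_def\<close>)
  have \<theta>2: "pd l (pd i \<theta>) = (\<lambda>q. if q \<in> ?C then partial S l (partial S i T) q else 0)" for i l
    unfolding \<theta>1 by (rule partial_extend_const[OF open_channel B CS]) (rule zT)
  have heat: "(\<Sum>i\<in>UNIV. V i q * pd i \<theta> q)
      - (\<Sum>i\<in>UNIV. (if i = 3 then \<kappa>\<^sub>3 else \<kappa>\<^sub>H) * pd i (pd i \<theta>) q) = 0" for q
    unfolding sum_3 \<theta>2 unfolding \<theta>1
    using assms(17) by (simp add: V_def \<Omega> advect_def laplacian_H_def algebra_simps)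
  have "\<theta> q = 0" for q
  proof (rule energy_rigidity[where J = "{()}" and f = "\<lambda>_. \<theta>" and V = V and l = 1
        and k = "\<lambda>i. if i = 3 then \<kappa>\<^sub>3 else \<kappa>\<^sub>H"])
    show "(\<Sum>j\<in>{()}. \<theta> q * ((\<Sum>i\<in>UNIV. V i q * pd i \<theta> q)
        - (\<Sum>i\<in>UNIV. (if i = 3 then \<kappa>\<^sub>3 else \<kappa>\<^sub>H) * pd i (pd i \<theta>) q))) = 0" for q
      unfolding heat by simp
  qed (use C\<theta> b\<theta> CV divV assms(2,3) in auto)
  then have Ta: "T q = a" if "q \<in> ?C" for q
    using that by (simp add: \<theta>_def) (metis eq_iff_diff_eq_0)
  have pq: "p q = - a * q $ 3 + b" if q: "q \<in> ?C" for q
  proof -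
    \<comment> \<open>A height below the box, where p is already known; from there p is integrated
      along the vertical line through q, using d_3 p = - T = - a.\<close>
    define z where "z = min (e / 2) (L / 2)"
    have z: "0 < z" "z < L" "z < e" using e(1) L by (auto simp: z_def)
    let ?o = "q - q $ 3 *\<^sub>R axis 3 1"
    have o: "?o + r *\<^sub>R axis 3 1 \<in> ?C" if "r \<in> {0<..<L}" for r
      using that by (simp add: channel_def)
    have "p (?o + q $ 3 *\<^sub>R axis 3 1) = p (?o + z *\<^sub>R axis 3 1) + (- a) * (q $ 3 - z)"
    proof (rule affine_along_axis[OF d1(1), where I = "{0<..<L}"])
      fix r assume "r \<in> {0<..<L}"
      from o[OF this] show "?o + r *\<^sub>R axis 3 1 \<in> interior S \<and> partial S 3 p (?o + r *\<^sub>R axis 3 1) = - a"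
        using Ci assms(16) Ta by (force simp: \<Omega>)
    qed (use q z in \<open>auto simp: channel_def\<close>)
    moreover have "?o + z *\<^sub>R axis 3 1 \<in> U"
      using z by (simp add: U_def B_def channel_def)
    then have "p (?o + z *\<^sub>R axis 3 1) = - a * z + b" by (simp add: ab(2))
    ultimately show ?thesis by (simp add: algebra_simps)
  qed
  have p12: "partial S i p q = 0" if q: "q \<in> ?C" and i: "i \<noteq> 3" for i q
    by (rule partial_eqI[OF d1(1) open_channel CS q, of "\<lambda>_. - a * q $ 3 + b"])
       (use i pq in \<open>auto simp: axis_def\<close>)

  let ?k = "\<lambda>i::3. if i = 3 then \<nu>\<^sub>3 else \<nu>\<^sub>H"
  \<comment> \<open>By \<open>p12\<close> the horizontal pressure gradient is gone, and the Coriolis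
    term is all that couples the two equations besides advection.\<close>
  have mom1: "(\<Sum>i\<in>UNIV. V i q * pd i (V 1) q) - (\<Sum>i\<in>UNIV. ?k i * pd i (pd i (V 1)) q) = R * V 2 q" for q
  proof (cases "q \<in> ?C")
    case True
    then show ?thesis
      unfolding sum_3 V2 unfolding V1 using bspec[OF assms(14), of q] p12[OF True, of 1]
      by (simp add: V_def \<Omega> uvw advect_def laplacian_H_def distrib_left)
  next
    case False
    then show ?thesis unfolding V2 by (simp add: V_def)
  qed
  have mom2: "(\<Sum>i\<in>UNIV. V i q * pd i (V 2) q) - (\<Sum>i\<in>UNIV. ?k i * pd i (pd i (V 2)) q) = - R * V 1 q" for q
  proof (cases "q \<in> ?C")
    case True
    then show ?thesis
      unfolding sum_3 V2 unfolding V1 using bspec[OF assms(15), of q] p12[OF True, of 2]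
      by (simp add: V_def \<Omega> uvw advect_def laplacian_H_def distrib_left)
  next
    case False
    then show ?thesis unfolding V2 by (simp add: V_def)
  qed
  note mom = mom1 mom2
  have V12: "V 1 q = 0 \<and> V 2 q = 0" for q
  proof (cases "\<nu>\<^sub>H = 0 \<and> \<nu>\<^sub>3 = 0")
    case False
    then have "?k 1 > 0 \<or> ?k 3 > 0" using assms(4,5) by auto
    then obtain l :: 3 where l: "?k l > 0" by blast
    \<comment> \<open>After testing with V 1 and V 2 the Coriolis contributions R V_1 V_2 and - R
      V_2 V_1 cancel in the sum over j.\<close>
    have "V j q = 0" if "j \<in> {1, 2}" for j
    proof (rule energy_rigidity[where J = "{1, 2}" and f = V and V = V and l = l and k = ?k])
      show "(\<Sum>j\<in>{1, 2}. V j q * ((\<Sum>i\<in>UNIV. V i q * pd i (V j) q)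
        - (\<Sum>i\<in>UNIV. ?k i * pd i (pd i (V j)) q))) = 0" for q
        using mom[of q] by simp
    qed (use CV bV divV l assms(4,5) that in auto)
    then show ?thesis by simp
  next
    case True
    then have k0: "?k i = 0" for i by simp
    have inert: "(\<Sum>i\<in>UNIV. V i q * pd i (V 1) q) = R * V 2 q"
      "(\<Sum>i\<in>UNIV. V i q * pd i (V 2) q) = - R * V 1 q" for q
      using mom[of q] unfolding k0 by simp_all
    show ?thesis
    proof (cases "R = 0")
      case True
      then show ?thesis
        using inertial_rigidity[of V, OF CV divV bV] inert by simp
    next
      case False
      show ?thesis
        by (rule inertial_circles_rigidity[of "V 1" "V 2" R "V 3", OF CV CV bV bV False])
           (use inert in \<open>simp_all add: sum_3\<close>)
    qed
  qed
  \<comment> \<open>With V 1 = V 2 = 0 the divergence condition reduces to d_3 V_3 = 0, and V 3 has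
    bounded support.\<close>
  have V3: "V 3 q = 0" for q
  proof (rule pd_zero_imp_zero[OF bV])
    have "pd i (V i) q = 0" if "i = 1 \<or> i = 2" for i q
      by (rule partial_eq_0_open[of UNIV _ _ _ 0]) (use V12 that in auto)
    then have "pd 3 (V 3) q = 0" for q
      using divV[of q] by (simp add: sum_3)
    then show "has_pd 3 (V 3) (\<lambda>_. 0)"
      using Ck_on_2D(1)[OF CV] by (rule has_pd_cong[rotated])
  qed
  have "X q = 0" if "q \<in> ?C" for q
    using V12[of q] V3[of q] that by (simp add: V_def vec_eq_iff forall_3)
  then show ?thesis using pq Ta by (auto simp: \<Omega>)
qed

end
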